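(* Let $d\geq 2$ be an integer. Let $t\geq 3$ and let $s$ be an even integer with $\frac{t+5}{2}\leq s\leq t+1$. Assume that $X\subset\mathbb{S}^{d-1}$ is an antipodal $s$-distance set with strength $t$. Then $$|X|\leq 2\binom{d+s-2}{s-1}-2h_{t-s+2},$$ where $h_0:=1$, $h_1:=d$, and $h_k:=\binom{d+k-1}{k}-\binom{d+k-3}{k-2}$ for $k\geq 2$.
   Context: For a finite set $X\subset\mathbb{S}^{d-1}$, its angle set is $A(X):=\{\langle \mathbf{x},\mathbf{y}\rangle:\mathbf{x},\mathbf{y}\in X,\ \mathbf{x}\neq\mathbf{y}\}$; $X$ is an $s$-distance set if $|A(X)|=s$. $X$ is a spherical $t$-design if $\int_{\mathbb{S}^{d-1}}f\,d\mu_d=\frac{1}{|X|}\sum_{\mathbf{x}\in X}f(\mathbf{x})$ for every polynomial $f$ of degree at most $t$, where $\mu_d$ is the normalized surface measure. $X$ has strength $t$ if $t$ is the largest integer such that $X$ is a spherical $t$-design. $X$ is antipodal if $X=-X$. *)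

theory Defs
  imports "HOL-Analysis.Analysis"
begin

text \<open>
  The normalized surface measure of the unit sphere: the radial projection of the uniform
  probability measure on the unit ball, so that the measure of a Borel set A of unit vectors
  is the fraction of the volume of the ball taken up by the cone over A.  It is a Borel measure
  on the whole space, concentrated on the sphere; the value 0 of the projection at the
  origin is immaterial.
\<close>

definition sphere_measure :: "(real ^ 'n) measure" where
  "sphere_measure = distr (uniform_measure lborel (ball 0 1)) borel (\<lambda>x. x /\<^sub>R norm x)"

text \<open>Here \<open>\<alpha>\<close> ranges over the exponent vectors of the monomials.\<close>

definition poly_fun_deg_le :: "nat \<Rightarrow> (real ^ 'n \<Rightarrow> real) \<Rightarrow> bool" where
  "poly_fun_deg_le k f \<longleftrightarrow>
     (\<exists>c :: ('n \<Rightarrow> nat) \<Rightarrow> real.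
        f = (\<lambda>x. \<Sum>\<alpha> | sum \<alpha> UNIV \<le> k. c \<alpha> * (\<Prod>i\<in>UNIV. (x $ i) ^ \<alpha> i)))"

definition angle_set :: "(real ^ 'n) set \<Rightarrow> real set" where
  "angle_set X = {x \<bullet> y | x y. x \<in> X \<and> y \<in> X \<and> x \<noteq> y}"

definition distance_set :: "nat \<Rightarrow> (real ^ 'n) set \<Rightarrow> bool" where
  "distance_set s X \<longleftrightarrow>
     finite X \<and> X \<subseteq> sphere 0 1 \<and> finite (angle_set X) \<and> card (angle_set X) = s"

definition spherical_design :: "nat \<Rightarrow> (real ^ 'n) set \<Rightarrow> bool" where
  "spherical_design t X \<longleftrightarrow>
     finite X \<and> X \<subseteq> sphere 0 1 \<and>
     (\<forall>f. poly_fun_deg_le t f \<longrightarrow>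
        (LINT x|sphere_measure. f x) = 1 / real (card X) * (\<Sum>x\<in>X. f x))"

definition has_strength :: "(real ^ 'n) set \<Rightarrow> nat \<Rightarrow> bool" where
  "has_strength X t \<longleftrightarrow> spherical_design t X \<and> (\<forall>t'. spherical_design t' X \<longrightarrow> t' \<le> t)"

definition antipodal :: "(real ^ 'n) set \<Rightarrow> bool" where
  "antipodal X \<longleftrightarrow> X = uminus ` X"

definition h_dim :: "nat \<Rightarrow> nat \<Rightarrow> int" where
  "h_dim d k =
     (if k = 0 then 1 else if k = 1 then int d
      else int ((d + k - 1) choose k) - int ((d + k - 3) choose (k - 2)))"

lemma finite_exponents: "finite {\<alpha> :: 'n::finite \<Rightarrow> nat. sum \<alpha> UNIV \<le> k}"
proof (rule finite_subset)
  show "{\<alpha> :: 'n \<Rightarrow> nat. sum \<alpha> UNIV \<le> k} \<subseteq> UNIV \<rightarrow>\<^sub>E {..k}"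
    by (auto simp: PiE_def) (meson UNIV_I finite member_le_sum order_trans zero_le)
  show "finite ((UNIV :: 'n set) \<rightarrow>\<^sub>E {..k})"
    by (simp add: finite_PiE)
qed

lemma measurable_radial [measurable]:
  "(\<lambda>x :: real ^ 'n. x /\<^sub>R norm x) \<in> borel_measurable borel"
  by measurable

lemma emeasure_unit_ball:
  "emeasure lborel (ball (0 :: real ^ 'n) 1) \<noteq> 0" "emeasure lborel (ball (0 :: real ^ 'n) 1) \<noteq> \<infinity>"
proof -
  have "0 < measure lborel (ball (0 :: real ^ 'n) 1)"
    using content_ball_pos[of 1 "0 :: real ^ 'n"] by (simp add: measure_completion)
  then show "emeasure lborel (ball (0 :: real ^ 'n) 1) \<noteq> 0"
    by (auto simp: measure_def)
  show "emeasure lborel (ball (0 :: real ^ 'n) 1) \<noteq> \<infinity>"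
    using emeasure_lborel_ball_finite[of "0 :: real ^ 'n" 1] by auto
qed

lemma emeasure_sphere_measure:
  fixes A :: "(real ^ 'n) set"
  assumes [measurable]: "A \<in> sets borel"
  shows "emeasure sphere_measure A =
    emeasure lborel {x \<in> ball 0 1. x /\<^sub>R norm x \<in> A} / emeasure lborel (ball (0 :: real ^ 'n) 1)"
proof -
  have *: "(\<lambda>x :: real ^ 'n. x /\<^sub>R norm x) -` A \<in> sets borel"
    using measurable_sets[OF measurable_radial assms] by simp
  have "ball 0 1 \<inter> (\<lambda>x. x /\<^sub>R norm x) -` A = {x \<in> ball 0 1. x /\<^sub>R norm x \<in> A}"
    by auto
  then show ?thesis
    unfolding sphere_measure_def using * by (simp add: emeasure_distr)
qed

lemma emeasure_sphere_measure_UNIV: "emeasure sphere_measure (UNIV :: (real ^ 'n) set) = 1"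
proof -
  have "emeasure lborel (ball (0 :: real ^ 'n) 1) / emeasure lborel (ball (0 :: real ^ 'n) 1) = 1"
    using emeasure_unit_ball[where 'n='n] by (intro ennreal_divide_self) (auto simp: top.not_eq_extremum)
  then show ?thesis
    by (subst emeasure_sphere_measure) (simp_all add: ball_def)
qed

lemma AE_sphere_measure: "AE x :: real ^ 'n in sphere_measure. x \<in> sphere 0 1"
proof -
  have "{x :: real ^ 'n. x \<in> ball 0 1 \<and> x /\<^sub>R norm x \<in> - sphere 0 1} = {0}"
    by (auto intro: ccontr)
  then have "emeasure sphere_measure (- sphere (0 :: real ^ 'n) 1) = 0"
    by (subst emeasure_sphere_measure) simp_all
  then show ?thesis
    by (intro AE_I[where N = "- sphere 0 1"]) (auto simp: sphere_measure_def)
qed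

end

theory Submission
  imports Defs "HOL-Library.Function_Algebras" "HOL-Computational_Algebra.Polynomial"
begin

text \<open>
  Put \<open>m = s - 1\<close> and \<open>k = t + 2 - s\<close>, both odd, with \<open>k + m = t + 1\<close>.  Besides \<open>-1\<close> and \<open>0\<close> the
  angles of \<open>X\<close> come in pairs \<open>\<plusminus>a\<close>, so \<open>\<phi>(u) = u \<Prod>(u\<^sup>2 - a\<^sup>2)\<close> is an odd polynomial of degree \<open>m\<close>,
  and the functions \<open>\<phi>(x \<bullet> y)\<close>, with \<open>y\<close> in one half \<open>Y\<close> of \<open>X\<close>, restrict to multiples of delta
  functions on \<open>Y\<close>.  Hence \<open>|Y|\<close> is at most the dimension of the forms of degree \<open>m\<close>, and every form
  vanishing on \<open>X\<close> improves this bound.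

  For a spherical harmonic \<open>h\<close> of degree \<open>k\<close> consider \<open>T h = \<Sum>\<^bsub>y\<in>X\<^esub> h(y) \<phi>(x \<bullet> y)\<close>, which agrees with
  \<open>2 \<phi>(1) h\<close> on \<open>X\<close>.  By the Funk-Hecke formula and the design property,
  \<open>T h = |X| c\<^sub>k h + g\<close> with a harmonic \<open>g\<close> of degree \<open>m\<close>.  If \<open>\<lambda> = 2 \<phi>(1) - |X| c\<^sub>k\<close> is nonzero, then
  the forms \<open>T h - 2 \<phi>(1) h\<close> vanish on \<open>X\<close> and are linearly independent, which gives the bound.
  If \<open>\<lambda> = 0\<close>, then \<open>g\<close> vanishes on \<open>X\<close>, which forces \<open>g = 0\<close>; so the harmonics of degrees \<open>k\<close> and
  \<open>m\<close> are orthogonal on \<open>X\<close>, and \<open>X\<close> is a \<open>(t + 1)\<close>-design, a contradiction.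
\<close>

section \<open>Functions as vectors, with two facts of linear algebra\<close>

instantiation "fun" :: (type, real_vector) real_vector
begin

definition scaleR_fun :: "real \<Rightarrow> ('a \<Rightarrow> 'b) \<Rightarrow> 'a \<Rightarrow> 'b"
  where "c *\<^sub>R f = (\<lambda>x. c *\<^sub>R f x)"

instance
  by standard (simp_all add: scaleR_fun_def fun_eq_iff scaleR_add_right scaleR_add_left)

end

lemma scaleR_fun_apply [simp]: "(c *\<^sub>R f) x = c *\<^sub>R f x"
  by (simp add: scaleR_fun_def)

lemma sum_fun_apply [simp]: "(\<Sum>i\<in>I. f i) x = (\<Sum>i\<in>I. f i x)" for f :: "'i \<Rightarrow> 'a \<Rightarrow> 'b::comm_monoid_add"
  by (induction I rule: infinite_finite_induct) auto

text \<open>By bilinearity, the partners whose product with a fixed factor stays in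
  \<open>span C\<close> form a subspace. The claim therefore passes from generators to spans, one
  factor at a time.\<close>

lemma span_times:
  fixes A B C :: "('a \<Rightarrow> real) set"
  assumes AB: "\<And>a b. a \<in> A \<Longrightarrow> b \<in> B \<Longrightarrow> a * b \<in> span C"
    and f: "f \<in> span A" and g: "g \<in> span B"
  shows "f * g \<in> span C"
proof -
  have scale: "(c *\<^sub>R f) * g = c *\<^sub>R (f * g)" "f * (c *\<^sub>R g) = c *\<^sub>R (f * g)"
    for c and f g :: "'a \<Rightarrow> real"
    by (auto simp: fun_eq_iff)
  have "subspace {f. f * b \<in> span C}" for b
    by (rule subspaceI) (simp_all add: span_zero distrib_right scale span_add span_scale)
  then have "span A \<subseteq> {f. f * b \<in> span C}" if "b \<in> B" for b
    using AB that by (intro span_minimal) auto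
  moreover have "subspace {g. f * g \<in> span C}"
    by (rule subspaceI) (simp_all add: span_zero distrib_left scale span_add span_scale)
  ultimately have "span B \<subseteq> {g. f * g \<in> span C}"
    using f by (intro span_minimal) auto
  then show ?thesis
    using g by auto
qed

text \<open>Working with an indexed family spares a separate injectivity argument: two equal members
  would satisfy the relation with coefficients 1 and -1.\<close>

lemma lin_indep_family_card_le:
  fixes f :: "'i \<Rightarrow> 'a::real_vector"
  assumes I: "finite I" and B: "finite B" and sp: "\<And>i. i \<in> I \<Longrightarrow> f i \<in> span B"
    and ind: "\<And>c i. (\<Sum>i\<in>I. c i *\<^sub>R f i) = 0 \<Longrightarrow> i \<in> I \<Longrightarrow> c i = 0"
  shows "card I \<le> card B"
proof -
  have inj: "inj_on f I"
  proof (rule inj_onI, rule ccontr)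
    fix i j assume ij: "i \<in> I" "j \<in> I" "f i = f j" "i \<noteq> j"
    let ?c = "\<lambda>l. if l = i then 1 else if l = j then -1 else (0::real)"
    have "(\<Sum>l\<in>I. ?c l *\<^sub>R f l) = (\<Sum>l\<in>{i,j}. ?c l *\<^sub>R f l)"
      by (rule sum.mono_neutral_right) (use I ij in auto)
    also have "\<dots> = 0"
      using ij by simp
    finally show False
      using ind[of ?c i] ij by simp
  qed
  have "independent (f ` I)"
    unfolding real_vector.dependent_finite[OF finite_imageI[OF I]]
  proof
    assume "\<exists>u. (\<exists>v\<in>f ` I. u v \<noteq> 0) \<and> (\<Sum>v\<in>f ` I. u v *\<^sub>R v) = 0"
    then obtain u i where u: "i \<in> I" "u (f i) \<noteq> 0" "(\<Sum>v\<in>f ` I. u v *\<^sub>R v) = 0"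
      by auto
    from u(3) have "(\<Sum>i\<in>I. u (f i) *\<^sub>R f i) = 0"
      by (simp add: sum.reindex[OF inj] o_def)
    from ind[OF this u(1)] u(2) show False
      by simp
  qed
  then have "card (f ` I) \<le> card B"
    using independent_span_bound[OF B] sp by blast
  then show ?thesis
    by (simp add: card_image[OF inj])
qed

subsection \<open>Homogeneous polynomials restricted to the sphere\<close>

text \<open>Extension by zero turns equality on the sphere into equality of functions, so
  restrictions to the sphere form a space of functions without any quotient.\<close>

definition sph :: "(real ^ 'n \<Rightarrow> real) \<Rightarrow> real ^ 'n \<Rightarrow> real"
  where "sph f = (\<lambda>x. if norm x = 1 then f x else 0)"

definition sph_monom :: "('n::finite \<Rightarrow> nat) \<Rightarrow> real ^ 'n \<Rightarrow> real"
  where "sph_monom \<alpha> = sph (\<lambda>x. \<Prod>i\<in>UNIV. (x $ i) ^ \<alpha> i)"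

definition exps :: "nat \<Rightarrow> ('n::finite \<Rightarrow> nat) set"
  where "exps k = {\<alpha>. sum \<alpha> UNIV = k}"

definition homp :: "nat \<Rightarrow> (real ^ 'n \<Rightarrow> real) set"
  where "homp k = span (sph_monom ` exps k)"

text \<open>The polynomials of degree \<open>k - 2\<close>; the shape of the definition makes this the zero
  space for \<open>k < 2\<close>, where truncated subtraction would give the constants.\<close>

definition lowp :: "nat \<Rightarrow> (real ^ 'n \<Rightarrow> real) set"
  where "lowp k = span (sph_monom ` {\<alpha>. sum \<alpha> UNIV + 2 = k})"

lemma finite_exps: "finite (exps k :: ('n::finite \<Rightarrow> nat) set)"
  by (rule finite_subset[OF _ finite_exponents[of k]]) (auto simp: exps_def)

lemma sph_apply: "norm x = 1 \<Longrightarrow> sph f x = f x" "norm x \<noteq> 1 \<Longrightarrow> sph f x = 0"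
  by (auto simp: sph_def)

lemma sph_times: "sph f * sph g = sph (\<lambda>x. f x * g x)"
  by (auto simp: sph_def fun_eq_iff)

lemma sph_add: "sph f + sph g = sph (\<lambda>x. f x + g x)"
  by (auto simp: sph_def fun_eq_iff)

lemma sph_diff: "sph f - sph g = sph (\<lambda>x. f x - g x)"
  by (auto simp: sph_def fun_eq_iff)

lemma sph_scaleR: "c *\<^sub>R sph f = sph (\<lambda>x. c * f x)"
  by (auto simp: sph_def fun_eq_iff)

lemma sph_sum: "(\<Sum>i\<in>I. sph (f i)) = sph (\<lambda>x. \<Sum>i\<in>I. f i x)"
  by (auto simp: sph_def fun_eq_iff)

lemma sph_cong: "(\<And>x. norm x = 1 \<Longrightarrow> f x = g x) \<Longrightarrow> sph f = sph g"
  by (auto simp: sph_def)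

lemma sph_monom_times: "sph_monom \<alpha> * sph_monom \<beta> = sph_monom (\<alpha> + \<beta>)"
  by (simp add: sph_monom_def sph_times power_add prod.distrib)

lemma subspace_homp: "subspace (homp k)" and subspace_lowp: "subspace (lowp k)"
  by (simp_all add: homp_def lowp_def)

lemma homp_subsetI:
  "subspace S \<Longrightarrow> (\<And>\<alpha>. sum \<alpha> UNIV = k \<Longrightarrow> sph_monom \<alpha> \<in> S) \<Longrightarrow> homp k \<subseteq> S"
  unfolding homp_def by (rule span_minimal) (auto simp: exps_def)

lemma lowp_Suc_Suc: "lowp (k + 2) = homp k"
  by (simp add: lowp_def homp_def exps_def)

lemma lowp_eq: "2 \<le> k \<Longrightarrow> lowp k = homp (k - 2)"
  using lowp_Suc_Suc[of "k - 2"] by (simp del: add_2_eq_Suc' add: le_add_diff_inverse2)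

lemma lowp_small: "k < 2 \<Longrightarrow> lowp k = {0}"
  by (auto simp: lowp_def)

lemma sph_monom_in: "sph_monom \<alpha> \<in> homp (sum \<alpha> UNIV)"
  by (auto simp: homp_def exps_def intro!: span_base)

lemma homp_times: "f \<in> homp j \<Longrightarrow> g \<in> homp k \<Longrightarrow> f * g \<in> homp (j + k)"
  unfolding homp_def
  by (erule (1) span_times[rotated])
     (auto intro!: span_base simp: sph_monom_times exps_def sum.distrib)

lemma lowp_times_homp: "f \<in> lowp j \<Longrightarrow> g \<in> homp k \<Longrightarrow> f * g \<in> lowp (j + k)"
  unfolding homp_def lowp_def
  by (erule (1) span_times[rotated])
     (auto intro!: span_base simp: sph_monom_times exps_def sum.distrib)

lemma homp_in_lowp: "f \<in> homp k \<Longrightarrow> l = k + 2 \<Longrightarrow> f \<in> lowp l"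
  by (simp only: lowp_Suc_Suc)

lemma homp_off_sphere: "f \<in> homp k \<Longrightarrow> norm x \<noteq> 1 \<Longrightarrow> f x = 0"
  unfolding homp_def
  by (induction rule: span_induct) (auto simp: subspace_def sph_monom_def sph_def)

lemma sph_one_in: "sph (\<lambda>_. 1) \<in> homp 0"
  using sph_monom_in[of "\<lambda>_. 0"] by (simp add: sph_monom_def)

lemma sph_coord_in: "sph (\<lambda>x. x $ i) \<in> homp 1"
proof -
  have "sum (\<lambda>j. if j = i then 1 else 0) UNIV = (1 :: nat)"
    by simp
  moreover have "sph_monom (\<lambda>j. if j = i then 1 else 0) = sph (\<lambda>x. x $ i)"
    unfolding sph_monom_def
    by (rule sph_cong) (simp add: if_distrib[of "power _"] cong: if_cong)
  ultimately show ?thesis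
    using sph_monom_in[of "\<lambda>j. if j = i then 1 else 0"] by simp
qed

lemma sph_inner_in: "sph (\<lambda>x. x \<bullet> y) \<in> homp 1"
proof -
  have "sph (\<lambda>x. x \<bullet> y) = (\<Sum>i\<in>UNIV. y $ i *\<^sub>R sph (\<lambda>x. x $ i))"
    by (simp add: sph_scaleR sph_sum inner_vec_def mult.commute)
  then show ?thesis
    by (simp only:) (intro subspace_sum[OF subspace_homp] subspace_scale[OF subspace_homp] sph_coord_in)
qed

lemma sph_power_in:
  assumes "sph f \<in> homp k"
  shows "sph (\<lambda>x. f x ^ j) \<in> homp (j * k)"
proof (induction j)
  case 0
  then show ?case
    by (simp add: sph_one_in)
next
  case (Suc j)
  show ?case
    using homp_times[OF assms Suc] by (simp add: sph_times)
qed

lemma sph_inner_power_in: "sph (\<lambda>x. (x \<bullet> y) ^ k) \<in> homp k"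
  using sph_power_in[OF sph_inner_in, of y k] by simp

lemma sph_prod_in:
  assumes "finite I" "\<And>i. i \<in> I \<Longrightarrow> sph (f i) \<in> homp (k i)"
  shows "sph (\<lambda>x. \<Prod>i\<in>I. f i x) \<in> homp (sum k I)"
  using assms
proof (induction I rule: finite_induct)
  case empty
  then show ?case
    by (simp add: sph_one_in)
next
  case (insert i I)
  then show ?case
    using homp_times[of "sph (f i)" "k i" "sph (\<lambda>x. \<Prod>i\<in>I. f i x)" "sum k I"]
    by (simp add: sph_times)
qed

lemma norm_eq_1_sum: "norm (x :: real ^ 'n) = 1 \<Longrightarrow> (\<Sum>i\<in>UNIV. (x $ i)\<^sup>2) = 1"
  by (simp add: norm_eq_1 inner_vec_def power2_eq_square)

text \<open>On the sphere the sum of the squared coordinates is 1, so multiplying by it raises the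
  degree by two and leaves the function unchanged. Spaces of the same parity are thus
  nested.\<close>

lemma homp_subset_add2: "homp k \<subseteq> homp (k + 2)"
proof
  fix f :: "real ^ 'n \<Rightarrow> real" assume f: "f \<in> homp k"
  have "f = f * sph (\<lambda>x. \<Sum>i\<in>UNIV. (x $ i)\<^sup>2)"
  proof
    fix x
    show "f x = (f * sph (\<lambda>x. \<Sum>i\<in>UNIV. (x $ i)\<^sup>2)) x"
      using homp_off_sphere[OF f, of x] norm_eq_1_sum[of x] by (simp add: sph_def)
  qed
  also have "sph (\<lambda>x. \<Sum>i\<in>UNIV. (x $ i)\<^sup>2) = (\<Sum>i\<in>UNIV. sph (\<lambda>x. (x $ i)\<^sup>2))"
    by (simp add: sph_sum)
  finally have "f = f * (\<Sum>i\<in>UNIV. sph (\<lambda>x. (x $ i)\<^sup>2))" .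
  moreover have "(\<Sum>i\<in>UNIV. sph (\<lambda>x :: real ^ 'n. (x $ i)\<^sup>2)) \<in> homp 2"
    using sph_power_in[OF sph_coord_in, of _ 2] by (auto intro!: subspace_sum[OF subspace_homp])
  ultimately show "f \<in> homp (k + 2)"
    using homp_times[OF f, of "\<Sum>i\<in>UNIV. sph (\<lambda>x. (x $ i)\<^sup>2)" 2] by argo
qed

lemma homp_mono: "homp k \<subseteq> homp (k + 2 * m)"
proof (induction m)
  case (Suc m)
  also have "homp (k + 2 * m) \<subseteq> homp (k + 2 * m + 2)"
    by (rule homp_subset_add2)
  finally show ?case
    by (simp add: algebra_simps)
qed simp

lemma homp_subset_homp: "k \<le> l \<Longrightarrow> even k = even l \<Longrightarrow> homp k \<subseteq> homp l"
  using homp_mono[of k "(l - k) div 2"] by simp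

lemma homp_subset_lowp: "k < l \<Longrightarrow> even k = even l \<Longrightarrow> homp k \<subseteq> lowp l"
proof -
  assume *: "k < l" "even k = even l"
  then have "2 \<le> l" "k \<le> l - 2" "even k = even (l - 2)"
    by (auto, presburger+)
  then show ?thesis
    using homp_subset_homp[of k "l - 2"] by (simp add: lowp_eq)
qed

lemma lowp_subset_homp: "lowp k \<subseteq> homp k"
proof (cases "k < 2")
  case True
  then show ?thesis
    using subspace_0[OF subspace_homp] by (auto simp: lowp_small)
next
  case False
  then show ?thesis
    using homp_subset_add2[of "k - 2"] by (simp add: lowp_eq del: add_2_eq_Suc')
qed

text \<open>A coordinate of \<open>R x\<close> is the inner product of \<open>x\<close> with a fixed
  vector, obtained from the adjoint. A monomial thus becomes a product of powers of linear forms of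
  the same total degree.\<close>

lemma homp_comp:
  fixes R :: "real ^ 'n \<Rightarrow> real ^ 'n"
  assumes R: "orthogonal_transformation R" and f: "f \<in> homp k"
  shows "f \<circ> R \<in> homp k"
proof -
  have "(f + g) \<circ> R = (f \<circ> R) + (g \<circ> R)" "(c *\<^sub>R f) \<circ> R = c *\<^sub>R (f \<circ> R)" "(0 :: real ^ 'n \<Rightarrow> real) \<circ> R = 0"
    for c and f g :: "real ^ 'n \<Rightarrow> real"
    by (auto simp: fun_eq_iff)
  then have "subspace {f. f \<circ> R \<in> homp k}"
    using subspace_homp[of k, where ?'a='n] by (intro subspaceI) (simp_all add: subspace_def)
  moreover have "sph_monom \<alpha> \<circ> R \<in> homp k" if \<alpha>: "sum \<alpha> UNIV = k" for \<alpha>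
  proof -
    have *: "R x $ i = x \<bullet> adjoint R (axis i 1)" for x i
      using adjoint_works[OF orthogonal_transformation_linear[OF R], of x "axis i 1"]
      by (simp add: inner_axis)
    have "sph_monom \<alpha> \<circ> R = sph (\<lambda>x. \<Prod>i\<in>UNIV. (x \<bullet> adjoint R (axis i 1)) ^ \<alpha> i)"
      using orthogonal_transformation_norm[OF R]
      by (auto simp: sph_monom_def sph_def fun_eq_iff *)
    also have "\<dots> \<in> homp k"
      using sph_prod_in[of UNIV "\<lambda>i x. (x \<bullet> adjoint R (axis i 1)) ^ \<alpha> i" \<alpha>] sph_inner_power_in \<alpha>
      by auto
    finally show ?thesis .
  qed
  ultimately have "homp k \<subseteq> {f. f \<circ> R \<in> homp k}"
    by (intro homp_subsetI) auto
  then show ?thesis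
    using f by auto
qed

lemma lowp_comp:
  fixes R :: "real ^ 'n \<Rightarrow> real ^ 'n"
  assumes R: "orthogonal_transformation R" and f: "f \<in> lowp k"
  shows "f \<circ> R \<in> lowp k"
proof (cases "k < 2")
  case True
  then show ?thesis
    using f by (auto simp: lowp_small fun_eq_iff)
next
  case False
  then show ?thesis
    using assms homp_comp by (simp add: lowp_eq)
qed

subsection \<open>Integration over the sphere\<close>

lemma space_sphere_measure [simp]: "space sphere_measure = UNIV"
  and sets_sphere_measure [measurable_cong, simp]: "sets sphere_measure = sets borel"
  by (simp_all add: sphere_measure_def)

lemma prob_sphere_measure: "finite_measure sphere_measure"
  by (rule finite_measureI) (simp add: emeasure_sphere_measure_UNIV)

text \<open>
  The library proves the invariance of Lebesgue measure under orthogonal maps of \<open>real ^ 'n\<close> only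
  for well-ordered \<open>'n\<close>.  It is transported to an arbitrary index type along a relabelling of
  the coordinates by a well-ordered copy of that type.
\<close>

typedef 'a wo_copy = "UNIV :: 'a set"
  by simp

instance wo_copy :: (finite) finite
proof
  have "bij (Rep_wo_copy :: 'a wo_copy \<Rightarrow> 'a)"
    by (metis type_definition.Abs_inverse type_definition.Rep_inverse type_definition_wo_copy
        UNIV_I bijI')
  then show "finite (UNIV :: 'a wo_copy set)"
    by (rule bij_betw_finite[THEN iffD2]) (rule finite_class.finite_UNIV)
qed

text \<open>An arbitrary injection along which the order of the natural numbers is pulled back; only
  its injectivity matters.\<close>

definition wo_index :: "'a::finite wo_copy \<Rightarrow> nat"
  where "wo_index = (SOME f. inj f)"

lemma inj_wo_index: "inj (wo_index :: 'a::finite wo_copy \<Rightarrow> nat)"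
proof -
  have "\<exists>f :: 'a wo_copy \<Rightarrow> nat. inj f"
    using finite_imp_inj_to_nat_seg[OF finite_class.finite_UNIV] by (elim exE conjE) (rule exI)
  then show ?thesis
    unfolding wo_index_def by (rule someI_ex)
qed

instantiation wo_copy :: (finite) linorder
begin

definition "x \<le> y \<longleftrightarrow> wo_index x \<le> wo_index y"

definition "x < y \<longleftrightarrow> wo_index x < wo_index y"

instance
  by standard (auto simp: less_eq_wo_copy_def less_wo_copy_def dest: injD[OF inj_wo_index])

end

instance wo_copy :: (finite) wellorder
proof -
  have "{(x, y :: 'a wo_copy). x < y} = inv_image less_than wo_index"
    by (auto simp: less_wo_copy_def)
  then have "wf {(x, y :: 'a wo_copy). x < y}"
    by simp
  then show "OFCLASS('a wo_copy, wellorder_class)"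
    by (rule wf_wellorderI) intro_classes
qed

lemma emeasure_lborel_box_cart:
  fixes l u :: "real ^ 'n"
  assumes "\<And>i. l $ i \<le> u $ i"
  shows "emeasure lborel (box l u) = ennreal (\<Prod>i\<in>UNIV. u $ i - l $ i)"
proof -
  have *: "\<And>b. b \<in> Basis \<Longrightarrow> l \<bullet> b \<le> u \<bullet> b"
    using assms by (auto simp: Basis_vec_def inner_axis)
  have "cbox l u \<noteq> {}"
    using * by (simp add: box_ne_empty)
  then have "measure lborel (cbox l u) = (\<Prod>i\<in>UNIV. u $ i - l $ i)"
    by (rule content_cbox_cart)
  then have "(\<Prod>b\<in>Basis. (u - l) \<bullet> b) = (\<Prod>i\<in>UNIV. u $ i - l $ i)"
    using * by (simp add: content_cbox_cases inner_diff_left)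
  then show ?thesis
    using * by (simp add: emeasure_lborel_box inner_diff_left)
qed

text \<open>Relabelling coordinates takes boxes to boxes with the same side lengths, and Lebesgue
  measure is determined by its values on boxes.\<close>

lemma distr_lborel_relabel:
  fixes p :: "'m::finite \<Rightarrow> 'n::finite"
  assumes p: "bij p"
  shows "distr lborel borel (\<lambda>x :: real ^ 'n. (\<chi> j. x $ p j) :: real ^ 'm) = lborel"
proof -
  let ?T = "\<lambda>x :: real ^ 'n. (\<chi> j. x $ p j) :: real ^ 'm"
  have cont: "continuous_on UNIV ?T"
    by (intro continuous_intros)
  then have meas [measurable]: "?T \<in> borel_measurable borel"
    by (rule borel_measurable_continuous_onI)
  have "lborel = distr lborel borel ?T"
  proof (rule lborel_eqI)
    fix l u :: "real ^ 'm" assume lu: "\<And>b. b \<in> Basis \<Longrightarrow> l \<bullet> b \<le> u \<bullet> b"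
    then have lu': "l $ j \<le> u $ j" for j
      using lu[of "axis j 1"] by (simp add: inner_axis axis_in_Basis_iff)
    let ?l = "\<chi> i. l $ inv p i" and ?u = "\<chi> i. u $ inv p i"
    have ip: "inv p (p j) = j" "p (inv p i) = i" for i j
      using p by (simp_all add: bij_is_inj bij_is_surj surj_f_inv_f)
    have "?T -` box l u = box ?l ?u"
    proof -
      have "(\<forall>j. l $ j < x $ p j \<and> x $ p j < u $ j) \<longleftrightarrow> (\<forall>i. l $ inv p i < x $ i \<and> x $ i < u $ inv p i)" for x :: "real ^ 'n"
        by (metis ip)
      then show ?thesis
        by (auto simp: mem_box_cart)
    qed
    then have "emeasure (distr lborel borel ?T) (box l u) = emeasure lborel (box ?l ?u)"
      by (simp add: emeasure_distr)
    also have "\<dots> = ennreal (\<Prod>i\<in>UNIV. u $ inv p i - l $ inv p i)"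
      using lu' by (subst emeasure_lborel_box_cart) auto
    also have "(\<Prod>i\<in>UNIV. u $ inv p i - l $ inv p i) = (\<Prod>j\<in>UNIV. u $ j - l $ j)"
      by (rule prod.reindex_bij_betw[OF bij_imp_bij_inv[OF p]])
    also have "ennreal \<dots> = emeasure lborel (box l u)"
      using lu' by (subst emeasure_lborel_box_cart) auto
    also have "\<dots> = ennreal (\<Prod>b\<in>Basis. (u - l) \<bullet> b)"
      using lu by (simp add: emeasure_lborel_box inner_diff_left)
    finally show "emeasure (distr lborel borel ?T) (box l u) = ennreal (\<Prod>b\<in>Basis. (u - l) \<bullet> b)" .
  qed simp
  then show ?thesis ..
qed

lemma measurable_orthogonal:
  fixes R :: "real ^ 'n \<Rightarrow> real ^ 'n"
  assumes "orthogonal_transformation R"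
  shows "R \<in> borel_measurable borel"
  using orthogonal_transformation_linear[OF assms]
  by (intro borel_measurable_continuous_onI) (simp add: linear_continuous_on linear_linear)

text \<open>The preimage of a box is its image under the inverse of \<open>R\<close>, which is
  orthogonal as well and preserves volume; values on boxes determine the measure.\<close>

lemma distr_lborel_orthogonal_wellorder:
  fixes R :: "real ^ 'n::{finite, wellorder} \<Rightarrow> real ^ 'n::_"
  assumes R: "orthogonal_transformation R"
  shows "distr lborel borel R = lborel"
proof -
  note meas [measurable] = measurable_orthogonal[OF R]
  have "lborel = distr lborel borel R"
  proof (rule lborel_eqI)
    fix l u :: "real ^ 'n::_" assume lu: "\<And>b. b \<in> Basis \<Longrightarrow> l \<bullet> b \<le> u \<bullet> b"
    have bij: "bij R"
      using R by (rule orthogonal_transformation_bij)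
    have inv: "orthogonal_transformation (inv R)"
      using R by (rule orthogonal_transformation_inv)
    have borel: "inv R ` box l u \<in> sets borel"
      using measurable_sets[OF meas, of "box l u"] bij by (simp add: bij_vimage_eq_inv_image)
    have "emeasure (distr lborel borel R) (box l u) = emeasure lborel (inv R ` box l u)"
      using bij by (simp add: emeasure_distr bij_vimage_eq_inv_image)
    also have "\<dots> = emeasure lebesgue (inv R ` box l u)"
      using borel by simp
    also have "\<dots> = ennreal (measure lebesgue (inv R ` box l u))"
      using fmeasurableD2[OF measurable_orthogonal_image[OF inv lmeasurable_box]]
      by (intro emeasure_eq_ennreal_measure) simp
    also have "\<dots> = ennreal (measure lebesgue (box l u))"
      by (simp add: measure_orthogonal_image[OF inv])
    also have "\<dots> = ennreal (\<Prod>b\<in>Basis. (u - l) \<bullet> b)"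
      using lu by (simp add: measure_lborel_box_eq inner_diff_left)
    finally show "emeasure (distr lborel borel R) (box l u) = ennreal (\<Prod>b\<in>Basis. (u - l) \<bullet> b)" .
  qed simp
  then show ?thesis ..
qed

text \<open>\<open>T\<close> and \<open>U\<close> are mutually inverse linear isometries between the
  space and its relabelled copy, both preserving Lebesgue measure. Conjugation by them moves
  \<open>R\<close> to the well-ordered copy.\<close>

lemma distr_lborel_orthogonal:
  fixes R :: "real ^ 'n \<Rightarrow> real ^ 'n"
  assumes R: "orthogonal_transformation R"
  shows "distr lborel borel R = lborel"
proof -
  note [measurable] = measurable_orthogonal[OF R]
  define T :: "real ^ 'n \<Rightarrow> real ^ 'n wo_copy" where "T = (\<lambda>x. \<chi> j. x $ Rep_wo_copy j)"
  define U :: "real ^ 'n wo_copy \<Rightarrow> real ^ 'n" where "U = (\<lambda>y. \<chi> i. y $ Abs_wo_copy i)"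
  have bij: "bij (Rep_wo_copy :: 'n wo_copy \<Rightarrow> 'n)" "bij (Abs_wo_copy :: 'n \<Rightarrow> 'n wo_copy)"
    by (metis Abs_wo_copy_inverse Rep_wo_copy_inverse UNIV_I bijI')+
  have dT: "distr lborel borel T = lborel" and dU: "distr lborel borel U = lborel"
    unfolding T_def U_def by (intro distr_lborel_relabel bij)+
  have UT [simp]: "U (T x) = x" and TU [simp]: "T (U y) = y" for x y
    by (simp_all add: T_def U_def vec_eq_iff Abs_wo_copy_inverse Rep_wo_copy_inverse)
  have linT: "linear T" and linU: "linear U"
    by (auto simp: T_def U_def linear_iff vec_eq_iff)
  have normT: "norm (T x) = norm x" for x
  proof -
    have "(\<Sum>j\<in>UNIV. (x $ Rep_wo_copy j)\<^sup>2) = (\<Sum>i\<in>UNIV. (x $ i)\<^sup>2)"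
      by (rule sum.reindex_bij_betw[OF bij(1)])
    then show ?thesis
      by (simp add: T_def norm_vec_def L2_set_def)
  qed
  then have normU: "norm (U y) = norm y" for y
    by (metis TU)
  have mT [measurable]: "T \<in> borel_measurable borel" and mU [measurable]: "U \<in> borel_measurable borel"
    using linT linU
    by (auto intro!: borel_measurable_continuous_onI simp: linear_continuous_on linear_linear)
  have "orthogonal_transformation (T \<circ> R \<circ> U)"
    using linT linU orthogonal_transformation_linear[OF R] orthogonal_transformation_norm[OF R]
    by (auto simp: orthogonal_transformation normT normU intro!: linear_compose)
  then have "distr lborel borel (T \<circ> R \<circ> U) = lborel"
    by (rule distr_lborel_orthogonal_wellorder)
  moreover have "R = U \<circ> (T \<circ> R \<circ> U) \<circ> T"
    by (simp add: fun_eq_iff)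
  moreover have "distr lborel borel (U \<circ> (T \<circ> R \<circ> U) \<circ> T) =
      distr (distr (distr lborel borel T) borel (T \<circ> R \<circ> U)) borel U"
    by (simp add: distr_distr o_assoc)
  ultimately show ?thesis
    by (simp add: dT dU)
qed

lemma distr_uniform_ball_orthogonal:
  fixes R :: "real ^ 'n \<Rightarrow> real ^ 'n"
  assumes R: "orthogonal_transformation R"
  shows "distr (uniform_measure lborel (ball 0 1)) borel R = uniform_measure lborel (ball 0 1)"
proof (rule measure_eqI)
  fix A assume "A \<in> sets (distr (uniform_measure lborel (ball 0 1)) borel R)"
  then have A [measurable]: "A \<in> sets borel"
    by simp
  note meas [measurable] = measurable_orthogonal[OF R]
  have "ball 0 1 \<inter> R -` A = R -` (ball 0 1 \<inter> A)"
    using orthogonal_transformation_norm[OF R] by auto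
  moreover have "emeasure lborel (R -` (ball 0 1 \<inter> A)) = emeasure (distr lborel borel R) (ball 0 1 \<inter> A)"
    by (simp add: emeasure_distr)
  moreover have "R -` A \<in> sets borel"
    using measurable_sets[OF meas A] by simp
  ultimately show "emeasure (distr (uniform_measure lborel (ball 0 1)) borel R) A =
      emeasure (uniform_measure lborel (ball 0 1)) A"
    by (simp add: emeasure_distr distr_lborel_orthogonal[OF R])
qed simp

text \<open>Radial projection commutes with \<open>R\<close>, so the invariance of the uniform
  measure on the ball passes to its projection.\<close>

lemma distr_sphere_measure_orthogonal:
  fixes R :: "real ^ 'n \<Rightarrow> real ^ 'n"
  assumes R: "orthogonal_transformation R"
  shows "distr sphere_measure borel R = sphere_measure"
proof -
  note meas [measurable] = measurable_orthogonal[OF R]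
  let ?U = "uniform_measure lborel (ball (0 :: real ^ 'n) 1)"
  let ?r = "\<lambda>x :: real ^ 'n. x /\<^sub>R norm x"
  have "R \<circ> ?r = ?r \<circ> R"
    using orthogonal_transformation_linear[OF R] orthogonal_transformation_norm[OF R]
    by (simp add: fun_eq_iff linear_scale)
  then have "distr sphere_measure borel R = distr (distr ?U borel R) borel ?r"
    unfolding sphere_measure_def by (subst (1 2) distr_distr) simp_all
  then show ?thesis
    by (simp add: distr_uniform_ball_orthogonal[OF R] sphere_measure_def)
qed

section \<open>Integrals of bounded Borel functions\<close>

definition sph_int :: "(real ^ 'n \<Rightarrow> real) \<Rightarrow> real"
  where "sph_int f = (LINT x|sphere_measure. f x)"

text \<open>A class closed under sums, multiples and products that contains every
  \<open>homp k\<close> and consists of integrable functions. Membership in it replaces all later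
  integrability arguments.\<close>

definition bounded_borel :: "(real ^ 'n \<Rightarrow> real) set"
  where "bounded_borel = {f. f \<in> borel_measurable borel \<and> (\<exists>C. \<forall>x. \<bar>f x\<bar> \<le> C)}"

lemma bounded_borelI: "f \<in> borel_measurable borel \<Longrightarrow> (\<And>x. \<bar>f x\<bar> \<le> C) \<Longrightarrow> f \<in> bounded_borel"
  by (auto simp: bounded_borel_def)

lemma bounded_borelE:
  assumes "f \<in> bounded_borel"
  obtains C where "f \<in> borel_measurable borel" "\<And>x. \<bar>f x\<bar> \<le> C" "0 \<le> C"
  using assms by (auto simp: bounded_borel_def) (meson abs_ge_zero order_trans)

lemma bounded_borel_times:
  assumes "f \<in> bounded_borel" "g \<in> bounded_borel"
  shows "f * g \<in> bounded_borel"
proof -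
  obtain C D where *: "f \<in> borel_measurable borel" "\<And>x. \<bar>f x\<bar> \<le> C" "0 \<le> C"
    "g \<in> borel_measurable borel" "\<And>x. \<bar>g x\<bar> \<le> D" "0 \<le> D"
    using assms by (metis bounded_borelE)
  show ?thesis
    using * by (intro bounded_borelI[of _ "C * D"]) (auto simp: times_fun_def abs_mult intro: mult_mono)
qed

lemma subspace_bounded_borel: "subspace bounded_borel"
proof (rule subspaceI)
  show "0 \<in> (bounded_borel :: (real ^ 'n \<Rightarrow> real) set)"
    by (rule bounded_borelI[of _ 0]) (auto simp: zero_fun_def)
next
  fix f g :: "real ^ 'n \<Rightarrow> real" assume "f \<in> bounded_borel" "g \<in> bounded_borel"
  then obtain C D where "f \<in> borel_measurable borel" "\<And>x. \<bar>f x\<bar> \<le> C"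
    "g \<in> borel_measurable borel" "\<And>x. \<bar>g x\<bar> \<le> D"
    by (metis bounded_borelE)
  then show "f + g \<in> bounded_borel"
    by (intro bounded_borelI[of _ "C + D"])
       (auto simp: plus_fun_def intro: order_trans[OF abs_triangle_ineq] add_mono)
next
  fix c and f :: "real ^ 'n \<Rightarrow> real" assume "f \<in> bounded_borel"
  then obtain C where "f \<in> borel_measurable borel" "\<And>x. \<bar>f x\<bar> \<le> C"
    by (metis bounded_borelE)
  then show "c *\<^sub>R f \<in> bounded_borel"
    by (intro bounded_borelI[of _ "\<bar>c\<bar> * C"])
       (auto simp: scaleR_fun_def abs_mult intro: mult_left_mono)
qed

lemma homp_subset_bounded_borel: "homp k \<subseteq> bounded_borel"
proof (rule homp_subsetI[OF subspace_bounded_borel])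
  fix \<alpha> :: "'a \<Rightarrow> nat"
  show "sph_monom \<alpha> \<in> bounded_borel"
  proof (rule bounded_borelI)
    fix x :: "real ^ 'a"
    show "\<bar>sph_monom \<alpha> x\<bar> \<le> 1"
    proof (cases "norm x = 1")
      case True
      then have "\<bar>x $ i\<bar> \<le> 1" for i
        using component_le_norm_cart[of x i] by simp
      then have "(\<Prod>i\<in>UNIV. \<bar>x $ i\<bar> ^ \<alpha> i) \<le> (\<Prod>i\<in>(UNIV::'a set). 1)"
        by (intro prod_mono) (auto intro: power_le_one)
      then show ?thesis
        using True by (simp add: sph_monom_def sph_def abs_prod power_abs)
    qed (simp add: sph_monom_def sph_def)
    show "sph_monom \<alpha> \<in> borel_measurable borel"
      unfolding sph_monom_def sph_def by measurable
  qed
qed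

lemma homp_bounded_borel: "f \<in> homp k \<Longrightarrow> f \<in> bounded_borel"
  using homp_subset_bounded_borel by blast

lemma integrable_bounded_borel:
  assumes "f \<in> bounded_borel"
  shows "integrable sphere_measure f"
proof -
  obtain C where "f \<in> borel_measurable borel" "\<And>x. \<bar>f x\<bar> \<le> C"
    using assms by (metis bounded_borelE)
  then show ?thesis
    by (intro finite_measure.integrable_const_bound[OF prob_sphere_measure, of _ C]) auto
qed

lemma sph_int_add: "f \<in> bounded_borel \<Longrightarrow> g \<in> bounded_borel \<Longrightarrow> sph_int (f + g) = sph_int f + sph_int g"
  unfolding sph_int_def plus_fun_apply
  by (rule Bochner_Integration.integral_add) (rule integrable_bounded_borel, assumption)+

lemma sph_int_scaleR: "sph_int (c *\<^sub>R f) = c * sph_int f"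
  by (simp add: sph_int_def)

lemma sph_int_comp:
  fixes R :: "real ^ 'n \<Rightarrow> real ^ 'n"
  assumes R: "orthogonal_transformation R" and f: "f \<in> bounded_borel"
  shows "sph_int (f \<circ> R) = sph_int f"
proof -
  note [measurable] = measurable_orthogonal[OF R]
  have [measurable]: "f \<in> borel_measurable borel"
    using f by (simp add: bounded_borel_def)
  have "sph_int f = (LINT x|distr sphere_measure borel R. f x)"
    by (simp add: sph_int_def distr_sphere_measure_orthogonal[OF R])
  also have "\<dots> = sph_int (f \<circ> R)"
    by (subst integral_distr) (simp_all add: sph_int_def)
  finally show ?thesis ..
qed

text \<open>Extension by zero makes the members of \<open>homp k\<close> jump at the sphere. The
  continuous representative is what permits topological arguments about them.\<close>

lemma homp_eq_sph:
  assumes "f \<in> homp k"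
  obtains g :: "real ^ 'n \<Rightarrow> real" where "continuous_on UNIV g" "f = sph g"
proof -
  have "\<exists>g. continuous_on UNIV g \<and> f = sph g"
    using assms unfolding homp_def
  proof (induction rule: span_induct_alt)
    case base
    show ?case
      by (rule exI[of _ "\<lambda>_. 0"]) (auto simp: sph_def)
  next
    case (step c f h)
    then obtain \<alpha> g where "f = sph_monom \<alpha>" "continuous_on UNIV g" "h = sph g"
      by auto
    then show ?case
      by (intro exI[of _ "\<lambda>x. c * (\<Prod>i\<in>UNIV. (x $ i) ^ \<alpha> i) + g x"])
         (auto simp: sph_monom_def sph_scaleR sph_add intro!: continuous_intros)
  qed
  then show ?thesis
    using that by blast
qed

text \<open>If \<open>f\<close> vanished almost everywhere but not at \<open>z\<close>, continuity
  would give a nonempty open set of points of the ball whose projections are not zeros of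
  \<open>f\<close>. Such a set is not negligible.\<close>

lemma sph_int_square_eq_0:
  fixes f :: "real ^ 'n \<Rightarrow> real"
  assumes f: "f \<in> homp k" and 0: "sph_int (f * f) = 0"
  shows "f = 0"
proof (rule ccontr)
  assume "f \<noteq> 0"
  then obtain z where z: "f z \<noteq> 0"
    by (auto simp: fun_eq_iff)
  then have nz: "norm z = 1"
    using homp_off_sphere[OF f] by blast
  obtain g where g: "continuous_on UNIV g" "f = sph g"
    using homp_eq_sph[OF f] .
  let ?r = "\<lambda>x :: real ^ 'n. x /\<^sub>R norm x"
  have [measurable]: "f \<in> borel_measurable borel"
    using homp_bounded_borel[OF f] by (simp add: bounded_borel_def)
  have "AE x in sphere_measure. f x * f x = 0"
    using 0 integrable_bounded_borel[OF homp_bounded_borel[OF homp_times[OF f f]]]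
    by (subst (asm) sph_int_def, subst (asm) integral_nonneg_eq_0_iff_AE) (auto simp: times_fun_def)
  then have "AE x in uniform_measure lborel (ball 0 1). f (?r x) = 0"
    unfolding sphere_measure_def by (subst (asm) AE_distr_iff) auto
  then have "AE x in lborel. x \<in> ball 0 1 \<longrightarrow> f (?r x) = 0"
    using emeasure_unit_ball[where ?'n='n] by (subst (asm) AE_uniform_measure) (auto simp: top.not_eq_extremum)
  then have ae: "AE x in lborel. \<not> (x \<in> ball 0 1 \<and> f (?r x) \<noteq> 0)"
    by eventually_elim auto
  \<comment> \<open>The origin is removed because the radial projection is not continuous
    there.\<close>
  let ?V = "(ball 0 1 - {0}) \<inter> {x. g (?r x) \<noteq> 0}"
  have cr: "continuous_on (ball 0 1 - {0}) (\<lambda>x. g (?r x))"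
    by (rule continuous_on_compose2[OF g(1)]) (auto intro!: continuous_intros)
  have "open ((ball 0 1 - {0}) \<inter> (\<lambda>x. g (?r x)) -` (- {0}))"
    by (rule continuous_open_preimage[OF cr]) auto
  also have "(ball 0 1 - {0}) \<inter> (\<lambda>x. g (?r x)) -` (- {0}) = ?V"
    by auto
  finally have "open ?V" .
  \<comment> \<open>This point lies inside the ball and projects to \<open>z\<close>.\<close>
  have "(1/2) *\<^sub>R z \<in> ?V"
    using z nz by (auto simp: g(2) sph_def)
  then have "?V \<noteq> {}"
    by (intro notI) (simp only: empty_iff)
  moreover have "negligible ?V"
  proof -
    have "AE x in lborel. x \<notin> ?V"
      using ae by eventually_elim (auto simp: g(2) sph_def divide_simps split: if_splits)
    then have "?V \<in> null_sets lborel"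
      using \<open>open ?V\<close> by (subst (asm) AE_iff_null_sets[symmetric]) auto
    then show ?thesis
      by (auto simp: negligible_iff_null_sets intro: null_sets_completionI)
  qed
  ultimately show False
    by (rule open_not_negligible[OF \<open>open ?V\<close>, THEN notE])
qed

section \<open>The inner product on the sphere and representing vectors\<close>

definition sph_ip :: "(real ^ 'n \<Rightarrow> real) \<Rightarrow> (real ^ 'n \<Rightarrow> real) \<Rightarrow> real"
  where "sph_ip f g = sph_int (f * g)"

lemma sph_ip_commute: "sph_ip f g = sph_ip g f"
  by (simp add: sph_ip_def mult.commute)

lemma sph_ip_add_left: "f \<in> bounded_borel \<Longrightarrow> g \<in> bounded_borel \<Longrightarrow> h \<in> bounded_borel \<Longrightarrow> sph_ip (f + g) h = sph_ip f h + sph_ip g h"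
  by (simp add: sph_ip_def distrib_right sph_int_add bounded_borel_times)

lemma sph_ip_scaleR_left: "sph_ip (c *\<^sub>R f) h = c * sph_ip f h"
proof -
  have "(c *\<^sub>R f) * h = c *\<^sub>R (f * h)"
    by (simp add: fun_eq_iff)
  then show ?thesis
    by (simp add: sph_ip_def sph_int_scaleR)
qed

lemma sph_ip_diff_left:
  assumes "f \<in> bounded_borel" "g \<in> bounded_borel" "h \<in> bounded_borel"
  shows "sph_ip (f - g) h = sph_ip f h - sph_ip g h"
  using sph_ip_add_left[of f "(-1) *\<^sub>R g" h] sph_ip_scaleR_left[of "-1" g h] assms
  by (simp add: subspace_neg[OF subspace_bounded_borel])

lemma sph_ip_zero_left: "sph_ip 0 h = 0"
  using sph_ip_scaleR_left[of 0 0 h] by simp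

lemma sph_ip_sum_left:
  assumes "\<And>i. i \<in> I \<Longrightarrow> f i \<in> bounded_borel" "h \<in> bounded_borel"
  shows "sph_ip (\<Sum>i\<in>I. f i) h = (\<Sum>i\<in>I. sph_ip (f i) h)"
  using assms
  by (induction I rule: infinite_finite_induct)
     (simp_all add: sph_ip_zero_left sph_ip_add_left subspace_sum[OF subspace_bounded_borel])

lemma sph_ip_add_right: "f \<in> bounded_borel \<Longrightarrow> g \<in> bounded_borel \<Longrightarrow> h \<in> bounded_borel \<Longrightarrow> sph_ip h (f + g) = sph_ip h f + sph_ip h g"
  using sph_ip_add_left[of f g h] by (simp add: sph_ip_commute[of h])

lemma sph_ip_scaleR_right: "sph_ip h (c *\<^sub>R f) = c * sph_ip h f"
  using sph_ip_scaleR_left[of c f h] by (simp add: sph_ip_commute[of h])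

lemma sph_ip_zero_right: "sph_ip h 0 = 0"
  using sph_ip_zero_left by (simp add: sph_ip_commute[of h])

lemma sph_ip_self_eq_0: "f \<in> homp k \<Longrightarrow> sph_ip f f = 0 \<Longrightarrow> f = 0"
  unfolding sph_ip_def by (rule sph_int_square_eq_0)

lemma sph_ip_comp:
  fixes R :: "real ^ 'n \<Rightarrow> real ^ 'n"
  assumes "orthogonal_transformation R" "f \<in> bounded_borel" "g \<in> bounded_borel"
  shows "sph_ip (f \<circ> R) (g \<circ> R) = sph_ip f g"
proof -
  have "(f \<circ> R) * (g \<circ> R) = (f * g) \<circ> R"
    by (simp add: fun_eq_iff)
  then show ?thesis
    using sph_int_comp[OF assms(1) bounded_borel_times[OF assms(2,3)]] by (simp add: sph_ip_def)
qed

text \<open>Gram-Schmidt, one basis vector at a time.\<close>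

lemma riesz_independent:
  assumes "finite B" "independent B" "B \<subseteq> homp k"
  shows "\<exists>b\<in>span B. \<forall>q\<in>B. sph_ip b q = l q"
  using assms
proof (induction B arbitrary: l rule: finite_induct)
  case empty
  show ?case
    by (auto intro: span_zero)
next
  case (insert w B)
  have w: "w \<notin> span B" "independent B" "B \<subseteq> homp k" "w \<in> homp k"
    using insert.prems insert.hyps by (auto simp: independent_insert)
  have spB: "span B \<subseteq> homp k"
    using w(3) by (rule span_minimal) (rule subspace_homp)
  obtain b where b: "b \<in> span B" "\<And>q. q \<in> B \<Longrightarrow> sph_ip b q = l q"
    using insert.IH[OF w(2,3), of l] by auto
  \<comment> \<open>The representer of \<open>sph_ip w\<close> is the orthogonal projection of
    \<open>w\<close> onto \<open>span B\<close>; hence \<open>w - p\<close> is orthogonal to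
    \<open>B\<close>, and nonzero by independence.\<close>
  obtain p where p: "p \<in> span B" "\<And>q. q \<in> B \<Longrightarrow> sph_ip p q = sph_ip w q"
    using insert.IH[OF w(2,3), of "sph_ip w"] by auto
  define v where "v = w - p"
  have bp: "b \<in> homp k" "p \<in> homp k"
    using spB b(1) p(1) by auto
  have v: "v \<in> homp k"
    unfolding v_def using w(4) bp(2) by (rule subspace_diff[OF subspace_homp])
  have bounded_borel: "w \<in> bounded_borel" "p \<in> bounded_borel" "v \<in> bounded_borel" "b \<in> bounded_borel" "\<And>q. q \<in> B \<Longrightarrow> q \<in> bounded_borel"
    using w bp v homp_subset_bounded_borel by blast+
  have vB: "sph_ip v q = 0" if "q \<in> B" for q
    using that bounded_borel p(2) by (simp add: v_def sph_ip_diff_left)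
  have "span B \<subseteq> {q \<in> bounded_borel. sph_ip v q = 0}"
    using vB bounded_borel subspace_bounded_borel
    by (intro span_minimal subspaceI)
       (auto simp: sph_ip_add_right sph_ip_scaleR_right subspace_def sph_ip_zero_right)
  then have vp: "sph_ip v p = 0"
    using p(1) by auto
  have "v \<noteq> 0"
    using w(1) p(1) by (auto simp: v_def)
  then have vv: "sph_ip v v \<noteq> 0"
    using sph_ip_self_eq_0 v by blast
  have "w = v + p"
    by (simp add: v_def)
  then have vw: "sph_ip v w = sph_ip v v"
    using bounded_borel vp by (simp add: sph_ip_add_right)
  \<comment> \<open>This value solves the one new equation, the one at \<open>w\<close>. The
    equations on \<open>B\<close> survive because \<open>v\<close> is orthogonal to
    \<open>B\<close>.\<close>
  define c where "c = (l w - sph_ip b w) / sph_ip v v"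
  have cv: "c *\<^sub>R v \<in> bounded_borel"
    using bounded_borel subspace_scale[OF subspace_bounded_borel] by blast
  have "sph_ip (b + c *\<^sub>R v) w = l w"
    using bounded_borel cv vv by (simp add: sph_ip_add_left sph_ip_scaleR_left vw c_def)
  moreover have "sph_ip (b + c *\<^sub>R v) q = l q" if "q \<in> B" for q
    using bounded_borel cv vB b(2) that by (simp add: sph_ip_add_left sph_ip_scaleR_left)
  moreover have "b + c *\<^sub>R v \<in> span (insert w B)"
    unfolding v_def using b(1) p(1)
    by (meson insertI1 span_add span_base span_diff span_mono span_scale subset_insertI subsetD)
  ultimately show ?case
    by auto
qed

lemma finite_basis_homp:
  assumes S: "subspace S" "S \<subseteq> homp k"
  obtains B where "finite B" "independent B" "span B = S"
proof -
  obtain B where B: "B \<subseteq> S" "independent B" "S \<subseteq> span B"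
    using maximal_independent_subset .
  have "B \<subseteq> span (sph_monom ` exps k)"
    using order_trans[OF B(1) S(2)] by (simp add: homp_def)
  then have "finite B"
    using independent_span_bound[OF finite_imageI[OF finite_exps] B(2)] by blast
  moreover have "span B = S"
    using B S(1) span_minimal by blast
  ultimately show ?thesis
    using that B(2) by blast
qed

text \<open>Linearity of \<open>l\<close> is asked for on \<open>S\<close> only, because functionals
  such as \<open>sph_ip f\<close> are known to be additive only on bounded Borel functions.\<close>

lemma riesz:
  assumes S: "subspace S" "S \<subseteq> homp k"
    and add: "\<And>f g. f \<in> S \<Longrightarrow> g \<in> S \<Longrightarrow> l (f + g) = l f + l g"
    and scale: "\<And>c f. f \<in> S \<Longrightarrow> l (c *\<^sub>R f) = c * l f"
  obtains b where "b \<in> S" "\<And>q. q \<in> S \<Longrightarrow> sph_ip b q = l q"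
proof -
  obtain B where B: "finite B" "independent B" "span B = S"
    using finite_basis_homp[OF S] .
  have "B \<subseteq> homp k"
    using B(3) S(2) span_superset by blast
  then obtain b where b: "b \<in> S" "\<And>q. q \<in> B \<Longrightarrow> sph_ip b q = l q"
    using riesz_independent[OF B(1,2), of k l] B(3) by auto
  have Sb: "f \<in> bounded_borel" if "f \<in> S" for f
    using that S(2) homp_subset_bounded_borel by blast
  have "l 0 = 0"
    using scale[OF subspace_0[OF S(1)], of 0] by simp
  then have "span B \<subseteq> {q \<in> S. sph_ip b q = l q}"
    using S(1) b Sb add scale B(3) span_superset[of B]
    by (intro span_minimal subspaceI)
       (auto simp: sph_ip_add_right sph_ip_scaleR_right subspace_def sph_ip_zero_right)
  then show ?thesis
    using that b(1) B(3) by auto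
qed

subsection \<open>Spherical harmonics\<close>

text \<open>The spherical harmonics of degree \<open>k\<close>, introduced without the Laplacian as
  the orthogonal complement of the lower degrees of the same parity.\<close>

definition sharm :: "nat \<Rightarrow> (real ^ 'n \<Rightarrow> real) set"
  where "sharm k = {f \<in> homp k. \<forall>p\<in>lowp k. sph_ip f p = 0}"

lemma lowp_bounded_borel: "f \<in> lowp k \<Longrightarrow> f \<in> bounded_borel"
  using lowp_subset_homp homp_subset_bounded_borel by blast

lemma subspace_sharm: "subspace (sharm k)"
  using subspace_homp[of k, where ?'a='a]
  by (intro subspaceI)
     (auto simp: sharm_def sph_ip_zero_left sph_ip_add_left sph_ip_scaleR_left homp_bounded_borel lowp_bounded_borel subspace_def)

lemma sharm_homp: "f \<in> sharm k \<Longrightarrow> f \<in> homp k"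
  by (simp add: sharm_def)

lemma sharm_bounded_borel: "f \<in> sharm k \<Longrightarrow> f \<in> bounded_borel"
  using sharm_homp homp_bounded_borel by blast

lemma sharm_lowp_ip: "f \<in> sharm k \<Longrightarrow> p \<in> lowp k \<Longrightarrow> sph_ip f p = 0"
  by (simp add: sharm_def)

lemma sharm_lowp_zero: "f \<in> sharm k \<Longrightarrow> f \<in> lowp k \<Longrightarrow> f = 0"
  using sharm_lowp_ip sph_ip_self_eq_0 sharm_homp by blast

text \<open>The component \<open>p\<close> is the orthogonal projection of \<open>f\<close> onto
  \<open>lowp k\<close>, that is, the representer of \<open>sph_ip f\<close> there.\<close>

lemma sharm_decomp:
  assumes f: "f \<in> homp k"
  obtains w p where "w \<in> sharm k" "p \<in> lowp k" "f = w + p"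
proof -
  obtain p where p: "p \<in> lowp k" "\<And>q. q \<in> lowp k \<Longrightarrow> sph_ip p q = sph_ip f q"
    using riesz[OF subspace_lowp lowp_subset_homp, of k "sph_ip f"] f
    by (auto simp: sph_ip_add_right sph_ip_scaleR_right homp_bounded_borel lowp_bounded_borel)
  have "f - p \<in> sharm k"
    using f p lowp_subset_homp[of k]
    by (auto simp: sharm_def sph_ip_diff_left homp_bounded_borel lowp_bounded_borel intro!: subspace_diff[OF subspace_homp])
  then show ?thesis
    using that[of "f - p" p] p(1) by simp
qed

text \<open>\<open>R\<close> preserves both the inner product and \<open>lowp k\<close>. As an
  involution it is its own inverse, so any \<open>p\<close> is again of the form
  \<open>p' \<circ> R\<close>; reflections are the only maps to which this is applied.\<close>

lemma sharm_comp:
  fixes R :: "real ^ 'n \<Rightarrow> real ^ 'n"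
  assumes R: "orthogonal_transformation R" and inv: "\<And>z. R (R z) = z" and f: "f \<in> sharm k"
  shows "f \<circ> R \<in> sharm k"
proof -
  have "sph_ip (f \<circ> R) p = 0" if p: "p \<in> lowp k" for p
  proof -
    have "p = (p \<circ> R) \<circ> R"
      by (simp add: fun_eq_iff inv)
    moreover have "sph_ip (f \<circ> R) ((p \<circ> R) \<circ> R) = sph_ip f (p \<circ> R)"
      using f p R by (intro sph_ip_comp) (auto intro: sharm_bounded_borel lowp_bounded_borel lowp_comp)
    ultimately show ?thesis
      using sharm_lowp_ip[OF f lowp_comp[OF R p]] by simp
  qed
  then show ?thesis
    using homp_comp[OF R sharm_homp[OF f]] by (simp add: sharm_def)
qed

text \<open>For distinct points this is the Householder reflection along \<open>a = x - x'\<close>.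
  It fixes the hyperplane orthogonal to \<open>a\<close>, which is the set of vectors with equal
  inner products with \<open>x\<close> and \<open>x'\<close>.\<close>

lemma exists_reflection:
  fixes x x' :: "real ^ 'n"
  assumes "norm x = norm x'"
  obtains R :: "real ^ 'n \<Rightarrow> real ^ 'n" where "orthogonal_transformation R" "\<And>z. R (R z) = z" "R x = x'"
    "\<And>y. x \<bullet> y = x' \<bullet> y \<Longrightarrow> R y = y"
proof (cases "x = x'")
  case True
  then show ?thesis
    using that[of "\<lambda>z. z"] by (simp add: orthogonal_transformation_id)
next
  case False
  define a where "a = x - x'"
  define R where "R = (\<lambda>z. z - (2 * (z \<bullet> a) / (a \<bullet> a)) *\<^sub>R a)"
  have a: "a \<bullet> a \<noteq> 0"
    using False by (simp add: a_def)
  have nn: "x \<bullet> x = x' \<bullet> x'"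
    using assms by (simp add: norm_eq)
  have "linear R"
    by (auto simp: R_def linear_iff inner_add_left algebra_simps add_divide_distrib)
  moreover have "R v \<bullet> R w = v \<bullet> w" for v w
    using a by (simp add: R_def inner_diff_left inner_diff_right inner_commute field_simps)
  ultimately have "orthogonal_transformation R"
    by (simp add: orthogonal_transformation_def)
  moreover have "R (R z) = z" for z
    using a by (simp add: R_def inner_diff_left field_simps)
  moreover have "2 * (x \<bullet> a) = a \<bullet> a"
    using nn by (simp add: a_def inner_diff_left inner_diff_right inner_commute)
  then have "R x = x'"
    using a by (simp add: R_def a_def)
  moreover have "R y = y" if "x \<bullet> y = x' \<bullet> y" for y
    using that by (simp add: R_def a_def inner_diff_right inner_commute)
  ultimately show ?thesis
    using that by blast
qed

subsection \<open>Zonal functions and the Funk-Hecke formula\<close>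

text \<open>Forms of degree \<open>k\<close> in two variables; they describe members of
  \<open>homp k\<close> on a great circle.\<close>

definition binary_form :: "nat \<Rightarrow> (real \<times> real \<Rightarrow> real) set"
  where "binary_form k = span ((\<lambda>(i, j) z. fst z ^ i * snd z ^ j) ` {(i, j). i + j = k})"

lemma subspace_binary_form: "subspace (binary_form k)"
  by (simp add: binary_form_def)

lemma binary_form_times: "f \<in> binary_form j \<Longrightarrow> g \<in> binary_form k \<Longrightarrow> f * g \<in> binary_form (j + k)"
  unfolding binary_form_def
proof (erule (1) span_times[rotated], clarsimp)
  fix a b c d :: nat assume "j = a + b" "k = c + d"
  then have "(\<lambda>z :: real \<times> real. fst z ^ a * snd z ^ b) * (\<lambda>z. fst z ^ c * snd z ^ d) \<in>
      (\<lambda>(i, j) z. fst z ^ i * snd z ^ j) ` {(i, l). i + l = j + k}"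
    by (intro image_eqI[of _ _ "(a + c, b + d)"]) (auto simp: power_add fun_eq_iff)
  from span_base[OF this]
  show "(\<lambda>z :: real \<times> real. fst z ^ a * snd z ^ b) * (\<lambda>z. fst z ^ c * snd z ^ d) \<in>
      span ((\<lambda>(i, j) z. fst z ^ i * snd z ^ j) ` {(i, l). i + l = a + b + (c + d)})"
    by (simp only: \<open>j = a + b\<close> \<open>k = c + d\<close>)
qed

lemma binary_form_one: "(\<lambda>_. 1) \<in> binary_form 0"
  unfolding binary_form_def by (rule span_base) auto

lemma binary_form_linear: "(\<lambda>z. fst z * a + snd z * b) \<in> binary_form 1"
proof -
  have "(\<lambda>z. fst z ^ i * snd z ^ j) \<in> binary_form 1" if "i + j = 1" for i j
    unfolding binary_form_def by (rule span_base) (use that in auto)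
  from this[of 1 0] this[of 0 1] have "(\<lambda>z. fst z) \<in> binary_form 1" "(\<lambda>z. snd z) \<in> binary_form 1"
    by auto
  then have "a *\<^sub>R (\<lambda>z. fst z) + b *\<^sub>R (\<lambda>z. snd z) \<in> binary_form 1"
    using subspace_binary_form by (blast intro: subspace_add subspace_scale)
  moreover have "a *\<^sub>R (\<lambda>z. fst z) + b *\<^sub>R (\<lambda>z. snd z) = (\<lambda>z. fst z * a + snd z * b)"
    by (auto simp: fun_eq_iff)
  ultimately show ?thesis
    by simp
qed

lemma binary_form_power: "f \<in> binary_form 1 \<Longrightarrow> (\<lambda>z. f z ^ k) \<in> binary_form k"
proof (induction k)
  case (Suc k)
  then show ?case
    using binary_form_times[of f 1 "\<lambda>z. f z ^ k" k] by (simp add: times_fun_def)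
qed (simp add: binary_form_one)

lemma binary_form_prod:
  assumes "finite I" "\<And>i. i \<in> I \<Longrightarrow> f i \<in> binary_form (k i)"
  shows "(\<lambda>z. \<Prod>i\<in>I. f i z) \<in> binary_form (sum k I)"
  using assms
proof (induction I rule: finite_induct)
  case (insert i I)
  then show ?case
    using binary_form_times[of "f i" "k i" "\<lambda>z. \<Prod>i\<in>I. f i z" "sum k I"] by (simp add: times_fun_def)
qed (simp add: binary_form_one)

text \<open>On the great circle through the orthonormal vectors \<open>y\<close> and
  \<open>e\<close> every coordinate is a linear form in \<open>u\<close> and \<open>v\<close>, so a
  monomial becomes a product of powers of such forms.\<close>

lemma homp_circle:
  fixes y e :: "real ^ 'n"
  assumes f: "f \<in> homp k" and ye: "norm y = 1" "norm e = 1" "y \<bullet> e = 0"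
  obtains g where "g \<in> binary_form k" "\<And>u v. u\<^sup>2 + v\<^sup>2 = 1 \<Longrightarrow> f (u *\<^sub>R y + v *\<^sub>R e) = g (u, v)"
proof -
  let ?P = "\<lambda>f g. g \<in> binary_form k \<and> (\<forall>u v. u\<^sup>2 + v\<^sup>2 = 1 \<longrightarrow> f (u *\<^sub>R y + v *\<^sub>R e) = g (u, v))"
  have "subspace {f. \<exists>g. ?P f g}"
  proof (rule subspaceI)
    show "0 \<in> {f. \<exists>g. ?P f g}"
      using subspace_0[OF subspace_binary_form, of k] by auto
  next
    fix f1 f2 assume "f1 \<in> {f. \<exists>g. ?P f g}" "f2 \<in> {f. \<exists>g. ?P f g}"
    then obtain g1 g2 where "?P f1 g1" "?P f2 g2"
      by blast
    then have "?P (f1 + f2) (g1 + g2)"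
      using subspace_add[OF subspace_binary_form, of g1 k g2] by simp
    then show "f1 + f2 \<in> {f. \<exists>g. ?P f g}"
      by blast
  next
    fix c f1 assume "f1 \<in> {f. \<exists>g. ?P f g}"
    then obtain g1 where "?P f1 g1"
      by blast
    then have "?P (c *\<^sub>R f1) (c *\<^sub>R g1)"
      using subspace_scale[OF subspace_binary_form, of g1 k c] by simp
    then show "c *\<^sub>R f1 \<in> {f. \<exists>g. ?P f g}"
      by blast
  qed
  moreover have "sph_monom \<alpha> \<in> {f. \<exists>g. ?P f g}" if \<alpha>: "sum \<alpha> UNIV = k" for \<alpha>
  proof -
    let ?g = "\<lambda>z. \<Prod>i\<in>UNIV. (fst z * y $ i + snd z * e $ i) ^ \<alpha> i"
    have "?g \<in> binary_form k"
      using binary_form_prod[of UNIV "\<lambda>i z. (fst z * y $ i + snd z * e $ i) ^ \<alpha> i" \<alpha>] binary_form_power[OF binary_form_linear] \<alpha>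
      by auto
    moreover have "norm (u *\<^sub>R y + v *\<^sub>R e) = 1" if "u\<^sup>2 + v\<^sup>2 = 1" for u v
      using that ye unfolding norm_eq_1
      by (simp add: inner_add_left inner_add_right inner_commute power2_eq_square)
    ultimately have "?P (sph_monom \<alpha>) ?g"
      by (simp add: sph_monom_def sph_def)
    then show ?thesis
      by blast
  qed
  ultimately have "homp k \<subseteq> {f. \<exists>g. ?P f g}"
    by (rule homp_subsetI)
  then obtain g where "?P f g"
    using f by blast
  then show ?thesis
    using that by blast
qed

text \<open>Dehomogenisation with respect to the second variable.\<close>

lemma binary_form_poly:
  assumes "g \<in> binary_form k"
  obtains q where "degree q \<le> k" "\<And>t w. g (t * w, w) = w ^ k * poly q t"
proof -
  let ?P = "\<lambda>(g :: real \<times> real \<Rightarrow> real) q. degree q \<le> k \<and> (\<forall>t w. g (t * w, w) = w ^ k * poly q t)"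
  have "subspace {g. \<exists>q. ?P g q}"
  proof (rule subspaceI)
    show "0 \<in> {g. \<exists>q. ?P g q}"
      by (auto intro!: exI[of _ 0])
  next
    fix f1 f2 :: "real \<times> real \<Rightarrow> real" assume "f1 \<in> {f. \<exists>g. ?P f g}" "f2 \<in> {f. \<exists>g. ?P f g}"
    then obtain g1 g2 where "?P f1 g1" "?P f2 g2"
      by blast
    then have "?P (f1 + f2) (g1 + g2)"
      by (simp add: degree_add_le distrib_left)
    then show "f1 + f2 \<in> {f. \<exists>g. ?P f g}"
      by blast
  next
    fix c and f1 :: "real \<times> real \<Rightarrow> real" assume "f1 \<in> {f. \<exists>g. ?P f g}"
    then obtain g1 where "?P f1 g1"
      by blast
    then have "?P (c *\<^sub>R f1) (smult c g1)"
      by (simp add: order_trans[OF degree_smult_le])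
    then show "c *\<^sub>R f1 \<in> {f. \<exists>g. ?P f g}"
      by blast
  qed
  moreover have "(\<lambda>z. fst z ^ i * snd z ^ j) \<in> {g. \<exists>q. ?P g q}" if "i + j = k" for i j
    using that by (auto intro!: exI[of _ "monom 1 i"] simp: degree_monom_eq poly_monom power_mult_distrib power_add)
  ultimately have "binary_form k \<subseteq> {g. \<exists>q. ?P g q}"
    unfolding binary_form_def by (intro span_minimal) auto
  then show ?thesis
    using that assms by blast
qed

lemma exists_orthogonal_unit:
  fixes y :: "real ^ 'n"
  assumes "CARD('n) \<ge> 2"
  obtains e :: "real ^ 'n" where "norm e = 1" "y \<bullet> e = 0"
proof -
  obtain z where z: "z \<noteq> 0" "orthogonal y z"
    using orthogonal_to_vector_exists[of y] assms by auto
  then show ?thesis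
    using that[of "z /\<^sub>R norm z"] by (simp add: orthogonal_def)
qed

text \<open>On the circle, \<open>u ^ k = (u\<^sup>2 + v\<^sup>2) g(u, v)\<close> would give \<open>t ^ k = (t\<^sup>2 + 1) q(t)\<close> for a
  polynomial \<open>q\<close> of degree less than \<open>k\<close>.\<close>

lemma inner_power_notin_lowp:
  fixes y :: "real ^ 'n"
  assumes "CARD('n) \<ge> 2" "norm y = 1"
  shows "sph (\<lambda>x. (x \<bullet> y) ^ k) \<notin> lowp k"
proof
  assume *: "sph (\<lambda>x. (x \<bullet> y) ^ k) \<in> lowp k"
  have y: "y \<bullet> y = 1"
    using assms(2) by (simp add: norm_eq_1)
  show False
  proof (cases "k < 2")
    case True
    with * have "sph (\<lambda>x. (x \<bullet> y) ^ k) = 0"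
      by (simp add: lowp_small)
    from fun_cong[OF this, of y] show False
      using assms y by (simp add: sph_apply)
  next
    case False
    then obtain l where l: "k = l + 2"
      by (metis add.commute le_Suc_ex not_less)
    obtain e :: "real ^ 'n" where e: "norm e = 1" "y \<bullet> e = 0"
      using exists_orthogonal_unit assms(1) by blast
    have "sph (\<lambda>x. (x \<bullet> y) ^ k) \<in> homp l"
      using * unfolding l lowp_Suc_Suc .
    then obtain g where g: "g \<in> binary_form l"
      "\<And>u v. u\<^sup>2 + v\<^sup>2 = 1 \<Longrightarrow> sph (\<lambda>x. (x \<bullet> y) ^ k) (u *\<^sub>R y + v *\<^sub>R e) = g (u, v)"
      using homp_circle assms(2) e by blast
    obtain q where q: "degree q \<le> l" "\<And>t w. g (t * w, w) = w ^ l * poly q t"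
      using binary_form_poly[OF g(1)] by blast
    have "t ^ k = (1 + t\<^sup>2) * poly q t" for t
    proof -
      \<comment> \<open>\<open>t * w\<close> and \<open>w\<close> are the coordinates of the point
        of the circle with ratio \<open>t\<close> and \<open>w > 0\<close>. Dividing by powers of
        \<open>w\<close> turns the identity on the circle into one in \<open>t\<close>
        alone.\<close>
      define w where "w = 1 / sqrt (1 + t\<^sup>2)"
      have pos: "1 + t\<^sup>2 > 0"
        by (simp add: add_pos_nonneg)
      then have w: "w > 0" "w\<^sup>2 * (1 + t\<^sup>2) = 1"
        by (simp_all add: w_def power_divide)
      then have 1: "(t * w)\<^sup>2 + w\<^sup>2 = 1"
        by (simp add: algebra_simps power_mult_distrib)
      have "norm ((t * w) *\<^sub>R y + w *\<^sub>R e) = 1"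
        using 1 e y unfolding norm_eq_1
        by (simp add: inner_add_left inner_add_right inner_commute power2_eq_square)
      then have "sph (\<lambda>x. (x \<bullet> y) ^ k) ((t * w) *\<^sub>R y + w *\<^sub>R e) = (t * w) ^ k"
        using y e(2) by (simp add: sph_apply inner_add_left inner_commute[of e y])
      then have "(t * w) ^ k = w ^ l * poly q t"
        using g(2)[OF 1] q(2) by simp
      then have "w\<^sup>2 * t ^ k = poly q t"
        using w(1) by (simp add: l power_mult_distrib power_add power2_eq_square ac_simps)
      then have "(1 + t\<^sup>2) * poly q t = (w\<^sup>2 * (1 + t\<^sup>2)) * t ^ k"
        by simp
      then show ?thesis
        using w(2) by simp
    qed
    then have "poly (monom 1 k) = poly ([:1, 0, 1:] * q)"
      by (auto simp: fun_eq_iff poly_monom power2_eq_square algebra_simps)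
    then have eq: "monom 1 k = [:1, 0, 1:] * q"
      by (simp only: poly_eq_poly_eq_iff)
    then have "q \<noteq> 0"
      by auto
    \<comment> \<open>The factor \<open>1 + t\<^sup>2\<close> does not vanish at 0, so
      \<open>q\<close> would need a zero of order \<open>k\<close> there, which exceeds its
      degree.\<close>
    have "k = order 0 ([:1, 0, 1:] * q)"
      using eq order_0_monom[of "1 :: real" k] by simp
    also have "\<dots> = order 0 [:1, 0, 1 :: real:] + order 0 q"
      using eq by (intro order_mult) (metis monom_eq_0_iff one_neq_zero)
    also have "order 0 [:1, 0, 1 :: real:] = 0"
      by (rule order_0I) simp
    also have "order 0 q \<le> degree q"
      using order_degree[OF \<open>q \<noteq> 0\<close>] .
    finally show False
      using q(1) l by simp
  qed
qed

text \<open>When the power of \<open>1 - (x \<bullet> y)\<^sup>2\<close> is expanded, all terms but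
  the leading one have smaller degree of the same parity and so lie in \<open>lowp\<close>. The
  induction yields \<open>c = (-1) ^ m\<close>.\<close>

lemma inner_power_times_in:
  fixes y :: "real ^ 'n"
  shows "\<exists>c. sph (\<lambda>x. (x \<bullet> y) ^ i * (1 - (x \<bullet> y)\<^sup>2) ^ m) - c *\<^sub>R sph (\<lambda>x. (x \<bullet> y) ^ (i + 2 * m)) \<in> lowp (i + 2 * m)
     \<and> sph (\<lambda>x. (x \<bullet> y) ^ i * (1 - (x \<bullet> y)\<^sup>2) ^ m) \<in> homp (i + 2 * m)"
proof (induction m)
  case 0
  have "sph (\<lambda>x. (x \<bullet> y) ^ i * (1 - (x \<bullet> y)\<^sup>2) ^ 0) = sph (\<lambda>x. (x \<bullet> y) ^ i)"
    by simp
  then show ?case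
    unfolding mult_0_right add_0_right
    by (simp only:) (intro exI[of _ 1] conjI sph_inner_power_in,
        simp only: scaleR_one diff_self subspace_0[OF subspace_lowp])
next
  case (Suc m)
  let ?A = "\<lambda>m. sph (\<lambda>x. (x \<bullet> y) ^ i * (1 - (x \<bullet> y)\<^sup>2) ^ m)"
  let ?U = "\<lambda>k. sph (\<lambda>x. (x \<bullet> y) ^ k)"
  from Suc obtain c where c: "?A m - c *\<^sub>R ?U (i + 2 * m) \<in> lowp (i + 2 * m)" and A: "?A m \<in> homp (i + 2 * m)"
    by blast
  have A': "?A m \<in> lowp (i + 2 * Suc m)"
    using A by (rule homp_in_lowp) simp
  have U2: "?U 2 \<in> homp 2"
    by (rule sph_inner_power_in)
  have UU: "(c *\<^sub>R ?U (i + 2 * m)) * ?U 2 = c *\<^sub>R ?U (i + 2 * Suc m)"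
    by (auto simp: fun_eq_iff sph_def power_add power2_eq_square)
  have rec: "?A (Suc m) = ?A m - ?A m * ?U 2"
    unfolding sph_times sph_diff by (rule sph_cong) (simp add: algebra_simps)
  have "(?A m - c *\<^sub>R ?U (i + 2 * m)) * ?U 2 \<in> lowp (i + 2 * m + 2)"
    using c U2 by (rule lowp_times_homp)
  then have p: "?A m * ?U 2 - c *\<^sub>R ?U (i + 2 * Suc m) \<in> lowp (i + 2 * Suc m)"
    by (simp add: left_diff_distrib UU)
  have "?A (Suc m) - (- c) *\<^sub>R ?U (i + 2 * Suc m) = ?A m - (?A m * ?U 2 - c *\<^sub>R ?U (i + 2 * Suc m))"
    unfolding rec by simp
  also have "\<dots> \<in> lowp (i + 2 * Suc m)"
    using A' p by (rule subspace_diff[OF subspace_lowp])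
  finally have "?A (Suc m) - (- c) *\<^sub>R ?U (i + 2 * Suc m) \<in> lowp (i + 2 * Suc m)" .
  moreover have "?A m * ?U 2 \<in> homp (i + 2 * m + 2)"
    using A U2 by (rule homp_times)
  then have "?A (Suc m) \<in> homp (i + 2 * Suc m)"
    unfolding rec using A' lowp_subset_homp[of "i + 2 * Suc m"]
    by (intro subspace_diff[OF subspace_homp]) auto
  ultimately show ?case
    by blast
qed

text \<open>A zonal function is determined by its values on one great circle through
  \<open>y\<close>, where it is a binary form in \<open>u = x \<bullet> y\<close> and
  \<open>v\<close> with \<open>v\<^sup>2 = 1 - u\<^sup>2\<close>. Averaging over the sign of
  \<open>v\<close> removes odd powers of \<open>v\<close>, and even powers are powers of
  \<open>1 - u\<^sup>2\<close>.\<close>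

lemma zonal_in_span:
  fixes y :: "real ^ 'n"
  assumes d: "CARD('n) \<ge> 2" and y: "norm y = 1" and f: "f \<in> homp k"
    and zonal: "\<And>x x'. norm x = 1 \<Longrightarrow> norm x' = 1 \<Longrightarrow> x \<bullet> y = x' \<bullet> y \<Longrightarrow> f x = f x'"
  obtains c where "f - c *\<^sub>R sph (\<lambda>x. (x \<bullet> y) ^ k) \<in> lowp k"
proof -
  obtain e :: "real ^ 'n" where e: "norm e = 1" "y \<bullet> e = 0"
    using exists_orthogonal_unit d by blast
  obtain g where g: "g \<in> binary_form k" "\<And>u v. u\<^sup>2 + v\<^sup>2 = 1 \<Longrightarrow> f (u *\<^sub>R y + v *\<^sub>R e) = g (u, v)"
    using homp_circle[OF f y e] by blast
  let ?v = "\<lambda>x. sqrt (1 - (x \<bullet> y)\<^sup>2)"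
  let ?S = "\<lambda>g. sph (\<lambda>x. g (x \<bullet> y, ?v x) + g (x \<bullet> y, - ?v x))"
  let ?U = "sph (\<lambda>x. (x \<bullet> y) ^ k)"
  let ?L = "span (insert ?U (lowp k))"
  have yy: "y \<bullet> y = 1" "e \<bullet> e = 1" "e \<bullet> y = 0"
    using y e by (simp_all add: norm_eq_1 inner_commute)
  have le: "(x \<bullet> y)\<^sup>2 \<le> 1" if "norm x = 1" for x
    using Cauchy_Schwarz_ineq2[of x y] that y by (simp add: abs_square_le_1)
  have "f = (1/2) *\<^sub>R ?S g"
  proof
    fix x
    show "f x = ((1/2) *\<^sub>R ?S g) x"
    proof (cases "norm x = 1")
      case True
      have sq: "(x \<bullet> y)\<^sup>2 + (?v x)\<^sup>2 = 1" "(x \<bullet> y)\<^sup>2 + (- ?v x)\<^sup>2 = 1"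
        using le[OF True] by simp_all
      \<comment> \<open>Zonality allows \<open>x\<close> to be replaced by a point of the circle at
        the same height, for either sign of \<open>w\<close>.\<close>
      have "f x = g (x \<bullet> y, w)" if w: "(x \<bullet> y)\<^sup>2 + w\<^sup>2 = 1" for w
      proof -
        have "norm ((x \<bullet> y) *\<^sub>R y + w *\<^sub>R e) = 1"
          using w yy unfolding norm_eq_1
          by (simp add: inner_add_left inner_add_right inner_commute power2_eq_square)
        then have "f x = f ((x \<bullet> y) *\<^sub>R y + w *\<^sub>R e)"
          using True yy by (intro zonal) (simp_all add: inner_add_left)
        then show ?thesis
          using g(2)[OF w] by simp
      qed
      from this[OF sq(1)] this[OF sq(2)] show ?thesis
        using True by (simp add: sph_apply)
    qed (use f in \<open>simp add: homp_off_sphere sph_apply\<close>)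
  qed
  moreover have "binary_form k \<subseteq> {g. ?S g \<in> ?L}"
    unfolding binary_form_def
  proof (rule span_minimal)
    have "?S (g + h) = ?S g + ?S h" "?S (c *\<^sub>R g) = c *\<^sub>R ?S g" "?S 0 = 0" for c g h
      by (auto simp: fun_eq_iff sph_def algebra_simps)
    then show "subspace {g. ?S g \<in> ?L}"
      by (intro subspaceI) (simp_all only: mem_Collect_eq span_add span_scale span_zero)
    show "(\<lambda>(i, j) z. fst z ^ i * snd z ^ j) ` {(i, j). i + j = k} \<subseteq> {g. ?S g \<in> ?L}"
    proof clarify
      fix i j assume k: "k = i + j"
      let ?m = "\<lambda>z :: real \<times> real. fst z ^ i * snd z ^ j"
      show "?S ?m \<in> span (insert (sph (\<lambda>x. (x \<bullet> y) ^ (i + j))) (lowp (i + j)))"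
      proof (cases "even j")
        case False
        then have "?S ?m = 0"
          by (auto simp: fun_eq_iff sph_def)
        then show ?thesis
          by (simp only: span_zero)
      next
        case True
        then obtain m where m: "j = 2 * m"
          by blast
        have "?S ?m = 2 *\<^sub>R sph (\<lambda>x. (x \<bullet> y) ^ i * (1 - (x \<bullet> y)\<^sup>2) ^ m)"
          using le by (auto simp: fun_eq_iff sph_def m power_mult)
        moreover have "sph (\<lambda>x. (x \<bullet> y) ^ i * (1 - (x \<bullet> y)\<^sup>2) ^ m) \<in>
            span (insert (sph (\<lambda>x. (x \<bullet> y) ^ (i + j))) (lowp (i + j)))"
          using inner_power_times_in[of y i m] unfolding m span_breakdown_eq
          by (auto simp: span_eq_iff[THEN iffD2, OF subspace_lowp])
        ultimately show ?thesis
          by (simp only: span_scale)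
      qed
    qed
  qed
  ultimately have "f \<in> ?L"
    using g(1) span_scale[of "?S g" _ "1/2"] by auto
  then show ?thesis
    using that unfolding span_breakdown_eq
    by (auto simp: span_eq_iff[THEN iffD2, OF subspace_lowp])
qed

text \<open>The representer of \<open>l\<close> is unique, so it inherits the invariance of
  \<open>l\<close> under reflections fixing \<open>y\<close>. Any two unit vectors at equal height
  over \<open>y\<close> are exchanged by such a reflection, so the representer is zonal.\<close>

lemma zonal_representer:
  fixes y :: "real ^ 'n"
  assumes d: "CARD('n) \<ge> 2" and y: "norm y = 1"
    and add: "\<And>f g. f \<in> sharm k \<Longrightarrow> g \<in> sharm k \<Longrightarrow> l (f + g) = l f + l g"
    and scale: "\<And>c f. f \<in> sharm k \<Longrightarrow> l (c *\<^sub>R f) = c * l f"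
    and inv: "\<And>R f. orthogonal_transformation R \<Longrightarrow> (\<And>z. R (R z) = z) \<Longrightarrow> R y = y \<Longrightarrow> f \<in> sharm k \<Longrightarrow>
      l (f \<circ> R) = l f"
  obtains a c where "a \<in> sharm k" "\<And>q. q \<in> sharm k \<Longrightarrow> sph_ip a q = l q"
    "a - c *\<^sub>R sph (\<lambda>x. (x \<bullet> y) ^ k) \<in> lowp k"
proof -
  have "sharm k \<subseteq> homp k"
    by (auto simp: sharm_def)
  then obtain a where a: "a \<in> sharm k" "\<And>q. q \<in> sharm k \<Longrightarrow> sph_ip a q = l q"
    using riesz[OF subspace_sharm, of k k l] add scale by blast
  have "a x = a x'" if x: "norm x = 1" "norm x' = 1" "x \<bullet> y = x' \<bullet> y" for x x'
  proof -
    obtain R :: "real ^ 'n \<Rightarrow> real ^ 'n" where R: "orthogonal_transformation R" "\<And>z. R (R z) = z"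
      "R x = x'" "\<And>z. x \<bullet> z = x' \<bullet> z \<Longrightarrow> R z = z"
      using exists_reflection[of x x'] x by auto
    have aR: "a \<circ> R \<in> sharm k"
      using R a by (intro sharm_comp)
    have "sph_ip (a \<circ> R) q = l q" if q: "q \<in> sharm k" for q
    proof -
      have qR: "q \<circ> R \<in> sharm k"
        using R q by (intro sharm_comp)
      have "(q \<circ> R) \<circ> R = q"
        using R(2) by (simp add: fun_eq_iff)
      then have "sph_ip (a \<circ> R) q = sph_ip a (q \<circ> R)"
        using sph_ip_comp[OF R(1) sharm_bounded_borel[OF a(1)] sharm_bounded_borel[OF qR]] by simp
      then show ?thesis
        using a(2)[OF qR] inv[OF R(1,2) R(4)[OF x(3)] q] by simp
    qed
    then have "sph_ip ((a \<circ> R) - a) q = 0" if "q \<in> sharm k" for q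
      using that a aR by (simp add: sph_ip_diff_left sharm_bounded_borel)
    moreover have "(a \<circ> R) - a \<in> sharm k"
      using aR a(1) by (rule subspace_diff[OF subspace_sharm])
    ultimately have "(a \<circ> R) - a = 0"
      using sph_ip_self_eq_0 sharm_homp by blast
    from fun_cong[OF this, of x] show ?thesis
      using R(3) by simp
  qed
  then obtain c where "a - c *\<^sub>R sph (\<lambda>x. (x \<bullet> y) ^ k) \<in> lowp k"
    using zonal_in_span[OF d y sharm_homp[OF a(1)]] by blast
  then show ?thesis
    using that a by blast
qed

text \<open>Pairing with \<open>F y\<close> and evaluation at \<open>y\<close> are both invariant
  under the reflections fixing \<open>y\<close>. Modulo \<open>lowp k\<close> their representers are
  multiples of one and the same power, which makes them proportional; reflections moving
  \<open>y\<close> show that the factor is the same at every point.\<close>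

lemma funk_hecke:
  fixes F :: "real ^ 'n \<Rightarrow> real ^ 'n \<Rightarrow> real"
  assumes d: "CARD('n) \<ge> 2" and F: "\<And>y. F y = sph (\<lambda>x. \<phi> (x \<bullet> y))"
    and bounded_borel: "\<And>y. norm y = 1 \<Longrightarrow> F y \<in> bounded_borel"
  obtains c where "\<And>y q. norm y = 1 \<Longrightarrow> q \<in> sharm k \<Longrightarrow> sph_ip (F y) q = c * q y"
proof -
  have FR: "sph_ip (F (R y)) q = sph_ip (F y) (q \<circ> R)"
    if R: "orthogonal_transformation R" "\<And>z. R (R z) = z" and y: "norm y = 1" and q: "q \<in> sharm k"
    for R y and q :: "real ^ 'n \<Rightarrow> real"
  proof -
    have "R x \<bullet> y = x \<bullet> R y" for x
      using R by (metis orthogonal_transformation_def)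
    then have "F y \<circ> R = F (R y)"
      using orthogonal_transformation_norm[OF R(1)] by (simp add: F sph_def fun_eq_iff)
    moreover have "(q \<circ> R) \<circ> R = q"
      using R(2) by (simp add: fun_eq_iff)
    moreover have "q \<circ> R \<in> bounded_borel"
      using q R by (intro sharm_bounded_borel sharm_comp)
    ultimately show ?thesis
      using sph_ip_comp[OF R(1) bounded_borel[OF y], of "q \<circ> R"] by simp
  qed
  obtain y :: "real ^ 'n" where y: "norm y = 1"
    using vector_choose_size[of 1] by auto
  have inv: "sph_ip (F y) (f \<circ> R) = sph_ip (F y) f"
    if "orthogonal_transformation R" "\<And>z. R (R z) = z" "R y = y" "f \<in> sharm k" for R f
    using FR[OF that(1,2) y that(4)] that(3) by simp
  obtain a \<alpha> where a: "a \<in> sharm k" "\<And>q. q \<in> sharm k \<Longrightarrow> sph_ip a q = sph_ip (F y) q"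
      "a - \<alpha> *\<^sub>R sph (\<lambda>x. (x \<bullet> y) ^ k) \<in> lowp k"
    by (rule zonal_representer[OF d y, of k "sph_ip (F y)"])
       (use inv bounded_borel[OF y] in \<open>auto simp: sph_ip_add_right sph_ip_scaleR_right sharm_bounded_borel\<close>)
  obtain b \<beta> where b: "b \<in> sharm k" "\<And>q. q \<in> sharm k \<Longrightarrow> sph_ip b q = q y"
      "b - \<beta> *\<^sub>R sph (\<lambda>x. (x \<bullet> y) ^ k) \<in> lowp k"
    by (rule zonal_representer[OF d y, of k "\<lambda>q. q y"]) auto
  have "\<exists>c. \<forall>q\<in>sharm k. sph_ip (F y) q = c * q y"
  proof (cases "\<beta> = 0")
    \<comment> \<open>Here every harmonic of degree \<open>k\<close> vanishes at \<open>y\<close>,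
      and by reflection everywhere, so any constant would do; 0 is taken.\<close>
    case True
    then have "b = 0"
      using b sharm_lowp_zero by simp
    then have qy: "q y = 0" if "q \<in> sharm k" for q :: "real ^ 'n \<Rightarrow> real"
      using b(2)[OF that] by (simp add: sph_ip_zero_left)
    have q0: "q = 0" if q: "q \<in> sharm k" for q :: "real ^ 'n \<Rightarrow> real"
    proof
      fix z :: "real ^ 'n"
      show "q z = 0 z"
      proof (cases "norm z = 1")
        case True
        then obtain R :: "real ^ 'n \<Rightarrow> real ^ 'n" where "orthogonal_transformation R" "\<And>z. R (R z) = z" "R y = z"
          using exists_reflection[of y z] y by auto
        then show ?thesis
          using qy[OF sharm_comp[OF _ _ q, of R]] by auto
      qed (use homp_off_sphere[OF sharm_homp[OF q]] in simp)
    qed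
    have "sph_ip (F y) q = 0 * q y" if "q \<in> sharm k" for q
      by (simp add: q0[OF that] sph_ip_zero_right)
    then show ?thesis
      by blast
  next
    case False
    let ?U = "sph (\<lambda>x. (x \<bullet> y) ^ k)"
    \<comment> \<open>This combination cancels the leading powers. It is harmonic of degree
      \<open>k\<close> and also in \<open>lowp k\<close>, hence zero.\<close>
    have "\<beta> *\<^sub>R (a - \<alpha> *\<^sub>R ?U) - \<alpha> *\<^sub>R (b - \<beta> *\<^sub>R ?U) \<in> lowp k"
      by (rule subspace_diff[OF subspace_lowp subspace_scale[OF subspace_lowp a(3)]
            subspace_scale[OF subspace_lowp b(3)]])
    also have "\<beta> *\<^sub>R (a - \<alpha> *\<^sub>R ?U) - \<alpha> *\<^sub>R (b - \<beta> *\<^sub>R ?U) = \<beta> *\<^sub>R a - \<alpha> *\<^sub>R b"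
      by (simp add: scaleR_diff_right mult.commute)
    finally have "\<beta> *\<^sub>R a - \<alpha> *\<^sub>R b = 0"
      using a(1) b(1)
      by (intro sharm_lowp_zero subspace_diff[OF subspace_sharm] subspace_scale[OF subspace_sharm])
    then have eq: "\<beta> *\<^sub>R a = \<alpha> *\<^sub>R b"
      by simp
    have "sph_ip (F y) q = \<alpha> / \<beta> * q y" if "q \<in> sharm k" for q
    proof -
      have "\<beta> * sph_ip a q = \<alpha> * sph_ip b q"
        using arg_cong[OF eq, of "\<lambda>f. sph_ip f q"] by (simp add: sph_ip_scaleR_left)
      then show ?thesis
        using a(2)[OF that] b(2)[OF that] False by (simp add: field_simps)
    qed
    then show ?thesis
      by blast
  qed
  then obtain c where c: "\<And>q. q \<in> sharm k \<Longrightarrow> sph_ip (F y) q = c * q y"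
    by blast
  have "sph_ip (F z) q = c * q z" if z: "norm z = 1" and q: "q \<in> sharm k" for z :: "real ^ 'n" and q :: "real ^ 'n \<Rightarrow> real"
  proof -
    obtain R :: "real ^ 'n \<Rightarrow> real ^ 'n" where R: "orthogonal_transformation R" "\<And>z. R (R z) = z" "R y = z"
      using exists_reflection[of y z] y z by auto
    then show ?thesis
      using FR[OF R(1,2) y q] c[OF sharm_comp[OF R(1,2) q]] by simp
  qed
  then show ?thesis
    using that by blast
qed

subsection \<open>Dimensions\<close>

text \<open>Enumerating the index type identifies exponent vectors with lists of fixed length and
  sum \<open>k\<close>, which are counted by stars and bars.\<close>

lemma card_exps: "card (exps k :: ('n::finite \<Rightarrow> nat) set) = (CARD('n) + k - 1) choose k"
proof -
  let ?n = "CARD('n)"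
  obtain e where e: "bij_betw e {0..<?n} (UNIV :: 'n set)"
    using ex_bij_betw_nat_finite[of "UNIV :: 'n set"] by auto
  let ?e' = "the_inv_into {0..<?n} e"
  have e': "?e' i < ?n" "e (?e' i) = i" for i
    using e the_inv_into_into[of e "{0..<?n}" i "{0..<?n}"] f_the_inv_into_f_bij_betw[OF e, of i]
    by (auto simp: bij_betw_def)
  have e'': "?e' (e j) = j" if "j < ?n" for j
    using e that by (intro the_inv_into_f_f) (auto simp: bij_betw_def)
  let ?L = "{l :: nat list. length l = ?n \<and> sum_list l = k}"
  have "bij_betw (\<lambda>\<alpha>. map (\<lambda>j. \<alpha> (e j)) [0..<?n]) (exps k) ?L"
  proof (rule bij_betw_byWitness[where f' = "\<lambda>l i. l ! ?e' i"])
    show "\<forall>\<alpha>\<in>exps k. (\<lambda>i. map (\<lambda>j. \<alpha> (e j)) [0..<?n] ! ?e' i) = \<alpha>"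
      using e' by (auto simp: fun_eq_iff)
    show "\<forall>l\<in>?L. map (\<lambda>j. l ! ?e' (e j)) [0..<?n] = l"
      using e'' by (auto intro!: nth_equalityI)
    have "sum_list (map (\<lambda>j. \<alpha> (e j)) [0..<?n]) = sum \<alpha> UNIV" for \<alpha> :: "'n \<Rightarrow> nat"
      using sum.reindex_bij_betw[OF e, of \<alpha>] by (simp add: interv_sum_list_conv_sum_set_nat)
    then show "(\<lambda>\<alpha>. map (\<lambda>j. \<alpha> (e j)) [0..<?n]) ` exps k \<subseteq> ?L"
      by (auto simp: exps_def)
    have "(\<Sum>i\<in>UNIV. l ! ?e' i) = sum_list l" if "length l = ?n" for l :: "nat list"
    proof -
      have "(\<Sum>i\<in>UNIV. l ! ?e' i) = (\<Sum>j\<in>{0..<?n}. l ! ?e' (e j))"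
        using sum.reindex_bij_betw[OF e, of "\<lambda>i. l ! ?e' i"] by simp
      also have "\<dots> = (\<Sum>j\<in>{0..<?n}. l ! j)"
        using e'' by simp
      finally show ?thesis
        using that by (simp add: sum_list_sum_nth)
    qed
    then show "(\<lambda>l i. l ! ?e' i) ` ?L \<subseteq> exps k"
      by (auto simp: exps_def)
  qed
  then have "card (exps k :: ('n \<Rightarrow> nat) set) = card ?L"
    by (rule bij_betw_same_card)
  also have "\<dots> = (k + ?n - 1) choose k"
    by (rule card_length_sum_list)
  finally show ?thesis
    by (simp add: add.commute)
qed

text \<open>Induction on the variables: with all but \<open>x j\<close> fixed, the relation is a
  polynomial in one variable, and its coefficient at \<open>\<gamma> j\<close> is a relation among
  the exponents agreeing with \<open>\<gamma>\<close> at \<open>j\<close>. Since members of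
  \<open>A\<close> are told apart by their values on \<open>S\<close>, only \<open>\<gamma>\<close>
  is left at the end.\<close>

lemma polynomial_function_coeff_zero:
  fixes c :: "('i \<Rightarrow> nat) \<Rightarrow> real"
  assumes "finite S" "finite A"
    and "\<And>\<alpha> \<beta>. \<alpha> \<in> A \<Longrightarrow> \<beta> \<in> A \<Longrightarrow> (\<And>i. i \<in> S \<Longrightarrow> \<alpha> i = \<beta> i) \<Longrightarrow> \<alpha> = \<beta>"
    and "\<And>x. (\<Sum>\<alpha>\<in>A. c \<alpha> * (\<Prod>i\<in>S. x i ^ \<alpha> i)) = 0"
    and "\<gamma> \<in> A"
  shows "c \<gamma> = 0"
  using assms
proof (induction S arbitrary: A rule: finite_induct)
  case empty
  then have "A = {\<gamma>}"
    by blast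
  then show ?case
    using empty.prems(3) by simp
next
  case (insert j S)
  let ?A = "{\<alpha> \<in> A. \<alpha> j = \<gamma> j}"
  have sum0: "(\<Sum>\<alpha>\<in>?A. c \<alpha> * (\<Prod>i\<in>S. x i ^ \<alpha> i)) = 0" for x
  proof -
    define p where "p = (\<Sum>\<alpha>\<in>A. monom (c \<alpha> * (\<Prod>i\<in>S. x i ^ \<alpha> i)) (\<alpha> j))"
    have "poly p u = 0" for u
    proof -
      have "(\<Prod>i\<in>S. (x(j := u)) i ^ \<alpha> i) = (\<Prod>i\<in>S. x i ^ \<alpha> i)" for \<alpha>
        using insert.hyps(2) by (intro prod.cong) auto
      then show ?thesis
        using insert.prems(3)[of "x(j := u)"] insert.hyps
        by (simp add: p_def poly_sum poly_monom mult_ac)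
    qed
    then have "p = 0"
      by (simp add: poly_all_0_iff_0[symmetric])
    then have "coeff p (\<gamma> j) = 0"
      by simp
    then show ?thesis
      using insert.prems(1) by (simp add: p_def coeff_sum sum.inter_filter)
  qed
  show ?case
  proof (rule insert.IH[of ?A])
    show "\<alpha> = \<beta>" if "\<alpha> \<in> ?A" "\<beta> \<in> ?A" "\<And>i. i \<in> S \<Longrightarrow> \<alpha> i = \<beta> i" for \<alpha> \<beta>
      using that by (intro insert.prems(2)) auto
  qed (use insert.prems sum0 in auto)
qed

text \<open>By homogeneity a relation on the sphere extends along rays to all nonzero vectors; at
  the origin all monomials of positive degree vanish.\<close>

lemma sph_monom_lin_indep:
  assumes k: "0 < k" and 0: "(\<Sum>\<alpha>\<in>exps k. c \<alpha> *\<^sub>R sph_monom \<alpha>) = 0" and \<gamma>: "\<gamma> \<in> exps k"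
  shows "c \<gamma> = 0"
proof (rule polynomial_function_coeff_zero[OF finite_class.finite_UNIV finite_exps _ _ \<gamma>])
  fix x :: "'a \<Rightarrow> real"
  let ?v = "\<chi> i. x i"
  show "(\<Sum>\<alpha>\<in>exps k. c \<alpha> * (\<Prod>i\<in>UNIV. x i ^ \<alpha> i)) = 0"
  proof (cases "?v = 0")
    case True
    have "(\<Prod>i\<in>UNIV. x i ^ \<alpha> i) = 0" if "\<alpha> \<in> exps k" for \<alpha>
    proof -
      have "sum \<alpha> UNIV \<noteq> 0"
        using that k by (simp add: exps_def)
      then obtain i where "\<alpha> i \<noteq> 0"
        by auto
      moreover have "x i = 0"
        using True by (simp add: vec_eq_iff)
      ultimately show ?thesis
        by (auto intro!: prod_zero bexI[of _ i])
    qed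
    then show ?thesis
      by (intro sum.neutral ballI) (simp only: mult_zero_right)
  next
    case False
    let ?w = "?v /\<^sub>R norm ?v"
    have "(\<Prod>i\<in>UNIV. x i ^ \<alpha> i) = norm ?v ^ k * sph_monom \<alpha> ?w" if "\<alpha> \<in> exps k" for \<alpha>
    proof -
      have x: "x i = norm ?v * ?w $ i" for i
        using False by simp
      have "x i ^ \<alpha> i = norm ?v ^ \<alpha> i * (?w $ i) ^ \<alpha> i" for i
        by (subst x[of i]) (rule power_mult_distrib)
      moreover have "norm ?w = 1"
        using False by simp
      moreover have "norm ?v ^ k = (\<Prod>i\<in>UNIV. norm ?v ^ \<alpha> i)"
        using that by (simp add: exps_def flip: power_sum)
      ultimately show ?thesis
        by (simp only: sph_monom_def sph_apply(1) prod.distrib)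
    qed
    then have "(\<Sum>\<alpha>\<in>exps k. c \<alpha> * (\<Prod>i\<in>UNIV. x i ^ \<alpha> i)) =
        norm ?v ^ k * (\<Sum>\<alpha>\<in>exps k. c \<alpha> *\<^sub>R sph_monom \<alpha>) ?w"
      by (simp add: sum_distrib_left mult_ac)
    then show ?thesis
      by (simp add: 0)
  qed
qed auto

text \<open>The monomials of degree \<open>k\<close> are independent and lie in the span of
  \<open>B\<close> and the monomials of degree \<open>k - 2\<close>; comparing cardinalities bounds
  the dimension of the harmonics from below.\<close>

lemma h_dim_le_card_basis:
  fixes B :: "(real ^ 'n \<Rightarrow> real) set"
  assumes k: "0 < k" and B: "finite B" "span B = sharm k"
  shows "h_dim CARD('n) k \<le> int (card B)"
proof -
  let ?N = "CARD('n)"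
  let ?M = "sph_monom ` {\<alpha> :: 'n \<Rightarrow> nat. sum \<alpha> UNIV + 2 = k}"
  have "{\<alpha> :: 'n \<Rightarrow> nat. sum \<alpha> UNIV + 2 = k} = (if k < 2 then {} else exps (k - 2))"
    by (auto simp: exps_def)
  then have fin: "finite {\<alpha> :: 'n \<Rightarrow> nat. sum \<alpha> UNIV + 2 = k}"
    and card: "card {\<alpha> :: 'n \<Rightarrow> nat. sum \<alpha> UNIV + 2 = k} = (if k < 2 then 0 else (?N + (k - 2) - 1) choose (k - 2))"
    by (simp_all add: card_exps finite_exps)
  have "sph_monom \<alpha> \<in> span (?M \<union> B)" if "\<alpha> \<in> exps k" for \<alpha>
  proof -
    have "sph_monom \<alpha> \<in> homp k"
      using sph_monom_in[of \<alpha>] that by (simp add: exps_def)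
    then obtain w p where "w \<in> sharm k" "p \<in> lowp k" "sph_monom \<alpha> = w + p"
      by (rule sharm_decomp)
    moreover from this have "w \<in> span (?M \<union> B)" "p \<in> span (?M \<union> B)"
      using B(2) span_mono[of B "?M \<union> B"] span_mono[of ?M "?M \<union> B"] by (auto simp: lowp_def)
    ultimately show ?thesis
      by (simp only: span_add)
  qed
  then have "card (exps k :: ('n \<Rightarrow> nat) set) \<le> card (?M \<union> B)"
    using B(1) fin sph_monom_lin_indep[OF k]
    by (intro lin_indep_family_card_le[where f = sph_monom]) (auto simp: finite_exps)
  also have "\<dots> \<le> card {\<alpha> :: 'n \<Rightarrow> nat. sum \<alpha> UNIV + 2 = k} + card B"
    using card_Un_le[of ?M B] card_image_le[OF fin, of sph_monom] by simp
  finally have *: "((?N + k - 1) choose k) \<le> (if k < 2 then 0 else (?N + (k - 2) - 1) choose (k - 2)) + card B"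
    unfolding card_exps card .
  show ?thesis
  proof (cases "k = 1")
    case True
    then show ?thesis
      using * by (simp add: h_dim_def)
  next
    case False
    then have "?N + (k - 2) - 1 = ?N + k - 3" "\<not> k < 2"
      using k by auto
    then show ?thesis
      using * False k by (simp add: h_dim_def)
  qed
qed

subsection \<open>Designs and antipodal sets\<close>

text \<open>Transfers the design property to restricted forms. A monomial and its restriction have
  the same integral because the measure is concentrated on the sphere.\<close>

lemma sum_design:
  fixes f :: "real ^ 'n \<Rightarrow> real"
  assumes X: "spherical_design t X" and f: "f \<in> homp k" and k: "k \<le> t"
  shows "(\<Sum>x\<in>X. f x) = real (card X) * sph_int f"
proof -
  have finX: "finite X" and XS: "X \<subseteq> sphere 0 1"
    using X by (auto simp: spherical_design_def)
  let ?S = "{f \<in> bounded_borel. (\<Sum>x\<in>X. f x) = real (card X) * sph_int f}"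
  have "sph_int (0 :: real ^ 'n \<Rightarrow> real) = 0"
    by (simp add: sph_int_def)
  then have "subspace ?S"
    using subspace_bounded_borel[where ?'a = 'n]
    by (intro subspaceI)
       (auto simp: subspace_def sph_int_add sph_int_scaleR sum.distrib distrib_left simp flip: sum_distrib_left)
  moreover have "sph_monom \<alpha> \<in> ?S" if \<alpha>: "sum \<alpha> UNIV = k" for \<alpha>
  proof -
    let ?g = "\<lambda>x :: real ^ 'n. \<Prod>i\<in>UNIV. (x $ i) ^ \<alpha> i"
    have "poly_fun_deg_le t ?g"
      unfolding poly_fun_deg_le_def
    proof (intro exI[of _ "\<lambda>\<beta>. if \<beta> = \<alpha> then 1 else 0"] ext)
      fix x :: "real ^ 'n"
      have "(\<Sum>\<beta> | sum \<beta> UNIV \<le> t. (if \<beta> = \<alpha> then 1 else 0) * (\<Prod>i\<in>UNIV. (x $ i) ^ \<beta> i)) =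
          (\<Sum>\<beta> | sum \<beta> UNIV \<le> t. if \<beta> = \<alpha> then ?g x else 0)"
        by (intro sum.cong) auto
      also have "\<dots> = ?g x"
        using \<alpha> k finite_exponents[of t] by (subst sum.delta) auto
      finally show "?g x = (\<Sum>\<beta> | sum \<beta> UNIV \<le> t. (if \<beta> = \<alpha> then 1 else 0) * (\<Prod>i\<in>UNIV. (x $ i) ^ \<beta> i))"
        by simp
    qed
    then have "(LINT x|sphere_measure. ?g x) = 1 / real (card X) * (\<Sum>x\<in>X. ?g x)"
      using X unfolding spherical_design_def by blast
    moreover have "(LINT x|sphere_measure. ?g x) = sph_int (sph_monom \<alpha>)"
      unfolding sph_int_def
    proof (rule integral_cong_AE)
      show "AE x in sphere_measure. ?g x = sph_monom \<alpha> x"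
        using AE_sphere_measure by eventually_elim (simp add: sph_monom_def sph_def)
      show "sph_monom \<alpha> \<in> borel_measurable sphere_measure"
        using integrable_bounded_borel[OF homp_bounded_borel[OF sph_monom_in]] by (rule borel_measurable_integrable)
    qed measurable
    moreover have "(\<Sum>x\<in>X. ?g x) = (\<Sum>x\<in>X. sph_monom \<alpha> x)"
      using XS by (intro sum.cong) (auto simp: sph_monom_def sph_def)
    \<comment> \<open>For empty \<open>X\<close> both sides are 0; otherwise the factor
      \<open>1 / real (card X)\<close> can be cleared.\<close>
    ultimately have "(\<Sum>x\<in>X. sph_monom \<alpha> x) = real (card X) * sph_int (sph_monom \<alpha>)"
      using finX by (cases "X = {}") (auto simp: field_simps)
    then show ?thesis
      using homp_bounded_borel[OF sph_monom_in] by simp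
  qed
  ultimately have "homp k \<subseteq> ?S"
    by (rule homp_subsetI)
  then show ?thesis
    using f by auto
qed

lemma spherical_design_Suc:
  fixes X :: "(real ^ 'n) set"
  assumes X: "spherical_design t X" "X \<noteq> {}"
    and top: "\<And>\<alpha>. sum \<alpha> UNIV = Suc t \<Longrightarrow> (\<Sum>x\<in>X. sph_monom \<alpha> x) = real (card X) * sph_int (sph_monom \<alpha>)"
  shows "spherical_design (Suc t) X"
  unfolding spherical_design_def
proof (intro conjI allI impI)
  show finX: "finite X" and XS: "X \<subseteq> sphere 0 1"
    using X by (auto simp: spherical_design_def)
  fix f :: "real ^ 'n \<Rightarrow> real" assume "poly_fun_deg_le (Suc t) f"
  let ?E = "{\<alpha> :: 'n \<Rightarrow> nat. sum \<alpha> UNIV \<le> Suc t}"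
  obtain c where c: "f = (\<lambda>x. \<Sum>\<alpha>\<in>?E. c \<alpha> * (\<Prod>i\<in>UNIV. (x $ i) ^ \<alpha> i))"
    using \<open>poly_fun_deg_le (Suc t) f\<close> unfolding poly_fun_deg_le_def by blast
  have fs: "f x = (\<Sum>\<alpha>\<in>?E. c \<alpha> * sph_monom \<alpha> x)" if "norm x = 1" for x
    using that by (simp add: c sph_monom_def sph_def)
  have mon: "(\<Sum>x\<in>X. sph_monom \<alpha> x) = real (card X) * sph_int (sph_monom \<alpha>)" if "\<alpha> \<in> ?E" for \<alpha>
    using that top sum_design[OF X(1) sph_monom_in, of \<alpha>] by (cases "sum \<alpha> UNIV = Suc t") auto
  have "(LINT x|sphere_measure. f x) = (LINT x|sphere_measure. (\<Sum>\<alpha>\<in>?E. c \<alpha> * sph_monom \<alpha> x))"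
  proof (rule integral_cong_AE)
    show "AE x in sphere_measure. f x = (\<Sum>\<alpha>\<in>?E. c \<alpha> * sph_monom \<alpha> x)"
      using AE_sphere_measure by eventually_elim (simp add: fs)
    show "f \<in> borel_measurable sphere_measure"
      unfolding c by measurable
    show "(\<lambda>x. \<Sum>\<alpha>\<in>?E. c \<alpha> * sph_monom \<alpha> x) \<in> borel_measurable sphere_measure"
      unfolding sph_monom_def sph_def by measurable
  qed
  also have "\<dots> = (\<Sum>\<alpha>\<in>?E. c \<alpha> * sph_int (sph_monom \<alpha>))"
    unfolding sph_int_def
    by (subst Bochner_Integration.integral_sum)
       (auto intro: integrable_bounded_borel homp_bounded_borel sph_monom_in)
  also have "\<dots> = (\<Sum>\<alpha>\<in>?E. c \<alpha> * (1 / real (card X) * (\<Sum>x\<in>X. sph_monom \<alpha> x)))"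
    using X(2) finX by (intro sum.cong) (auto simp: mon)
  also have "\<dots> = 1 / real (card X) * (\<Sum>x\<in>X. \<Sum>\<alpha>\<in>?E. c \<alpha> * sph_monom \<alpha> x)"
    unfolding sum_distrib_left by (subst sum.swap) (simp add: mult_ac)
  also have "(\<Sum>x\<in>X. \<Sum>\<alpha>\<in>?E. c \<alpha> * sph_monom \<alpha> x) = (\<Sum>x\<in>X. f x)"
    using XS by (intro sum.cong) (auto simp: fs)
  finally show "(LINT x|sphere_measure. f x) = 1 / real (card X) * (\<Sum>x\<in>X. f x)" .
qed

lemma homp_uminus: "f \<in> homp k \<Longrightarrow> f (- x) = (- 1) ^ k * f x"
proof -
  assume f: "f \<in> homp k"
  let ?S = "{f :: real ^ 'a \<Rightarrow> real. \<forall>x. f (- x) = (- 1) ^ k * f x}"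
  have "subspace ?S"
    by (intro subspaceI) (auto simp: distrib_left)
  moreover have "sph_monom \<alpha> \<in> ?S" if "sum \<alpha> UNIV = k" for \<alpha>
  proof -
    have "(\<Prod>i\<in>UNIV. (- (x $ i)) ^ \<alpha> i) = (- 1) ^ k * (\<Prod>i\<in>UNIV. (x $ i) ^ \<alpha> i)" for x :: "real ^ 'a"
      by (subst power_minus) (simp add: prod.distrib that flip: power_sum)
    then show ?thesis
      by (simp add: sph_monom_def sph_def)
  qed
  ultimately have "homp k \<subseteq> ?S"
    by (rule homp_subsetI)
  then show ?thesis
    using f by blast
qed

text \<open>The map \<open>uminus\<close> is orthogonal and reverses the sign of a form of odd
  degree.\<close>

lemma sph_int_odd:
  fixes f :: "real ^ 'n \<Rightarrow> real"
  assumes f: "f \<in> homp k" and k: "odd k"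
  shows "sph_int f = 0"
proof -
  have "f \<circ> uminus = (- 1) *\<^sub>R f"
    using homp_uminus[OF f] k by (simp add: fun_eq_iff)
  moreover have "orthogonal_transformation (uminus :: real ^ 'n \<Rightarrow> real ^ 'n)"
    by (simp add: orthogonal_transformation_def linear_iff)
  ultimately have "sph_int f = - sph_int f"
    using sph_int_comp[OF _ homp_bounded_borel[OF f], of uminus] sph_int_scaleR[of "-1" f] by simp
  then show ?thesis
    by simp
qed

lemma sum_antipodal_odd:
  assumes X: "antipodal X" and f: "f \<in> homp k" and k: "odd k"
  shows "(\<Sum>x\<in>X. f x) = 0"
proof -
  have "(\<Sum>x\<in>X. f x) = (\<Sum>x\<in>uminus ` X. f x)"
    using X by (simp add: antipodal_def)
  also have "\<dots> = (\<Sum>x\<in>X. f (- x))"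
    by (subst sum.reindex) auto
  also have "\<dots> = - (\<Sum>x\<in>X. f x)"
    using homp_uminus[OF f] k by (simp add: sum_negf)
  finally show ?thesis
    by simp
qed

text \<open>For odd degree both the sum over \<open>X\<close> and the integral of a monomial vanish,
  so a design of even degree \<open>t\<close> would automatically be one of degree
  \<open>t + 1\<close>.\<close>

lemma antipodal_strength_odd:
  assumes "antipodal X" "has_strength X t" "X \<noteq> {}"
  shows "odd t"
proof (rule ccontr)
  assume "\<not> odd t"
  then have "odd (Suc t)"
    by simp
  have "spherical_design (Suc t) X"
  proof (rule spherical_design_Suc)
    fix \<alpha> :: "'a \<Rightarrow> nat" assume "sum \<alpha> UNIV = Suc t"
    then have "odd (sum \<alpha> UNIV)"
      using \<open>odd (Suc t)\<close> by simp
    then show "(\<Sum>x\<in>X. sph_monom \<alpha> x) = real (card X) * sph_int (sph_monom \<alpha>)"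
      using sum_antipodal_odd[OF assms(1) sph_monom_in[of \<alpha>]] sph_int_odd[OF sph_monom_in[of \<alpha>]] by simp
  qed (use assms in \<open>auto simp: has_strength_def\<close>)
  then show False
    using assms(2) by (force simp: has_strength_def)
qed

lemma unit_neq_uminus:
  fixes x :: "'a::real_normed_vector"
  assumes "norm x = 1"
  shows "x \<noteq> - x"
proof
  assume "x = - x"
  then have "2 *\<^sub>R x = 0"
    by (simp add: scaleR_2 eq_neg_iff_add_eq_0)
  then show False
    using assms by simp
qed

lemma antipodal_half:
  fixes X :: "'a::real_normed_vector set"
  assumes X: "X = uminus ` X" "finite X" "X \<subseteq> sphere 0 1"
  obtains Y where "Y \<subseteq> X" "card X = 2 * card Y" "\<And>y. y \<in> Y \<Longrightarrow> - y \<notin> Y"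
proof -
  \<comment> \<open>The choice depends only on the unordered pair, so \<open>r (- x) = r x\<close>,
    and the fixed points of \<open>r\<close> pick one point from each pair.\<close>
  define r where "r x = (SOME z. z \<in> {x, - x})" for x :: 'a
  have r: "r x \<in> {x, - x}" for x
    unfolding r_def by (rule someI) auto
  have r_minus: "r (- x) = r x" for x
    by (simp add: r_def insert_commute)
  define Y where "Y = {x \<in> X. r x = x}"
  have XY: "X = Y \<union> uminus ` Y"
  proof (intro equalityI subsetI)
    fix x assume "x \<in> X"
    moreover from this have "- x \<in> X"
      using X(1) by blast
    ultimately show "x \<in> Y \<union> uminus ` Y"
      using r[of x] r_minus[of x] by (force simp: Y_def image_iff)
  qed (use X(1) in \<open>auto simp: Y_def\<close>)
  have dis: "- y \<notin> Y" if "y \<in> Y" for y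
  proof
    assume "- y \<in> Y"
    then have "- y = y"
      using that r_minus[of y] by (simp add: Y_def)
    moreover have "norm y = 1"
      using that X(3) by (auto simp: Y_def)
    ultimately show False
      using unit_neq_uminus[of y] by simp
  qed
  have "finite Y"
    using X(2) by (simp add: Y_def)
  then have "card X = card Y + card (uminus ` Y)"
    using dis by (subst XY, subst card_Un_disjoint) auto
  also have "card (uminus ` Y) = card Y"
    by (rule card_image) auto
  finally show ?thesis
    using that[of Y] dis by (auto simp: Y_def)
qed

text \<open>Multiplication by a factor \<open>u\<^sup>2 - b\<^sup>2\<close> raises the leading power
  by two, while the part with \<open>b\<^sup>2\<close> keeps its degree and falls into the new
  \<open>lowp\<close>. The leading coefficient stays 1.\<close>

lemma angle_poly_in:
  fixes y :: "real ^ 'n"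
  assumes "finite P"
  shows "sph (\<lambda>x. (x \<bullet> y) * (\<Prod>a\<in>P. (x \<bullet> y)\<^sup>2 - a\<^sup>2)) - sph (\<lambda>x. (x \<bullet> y) ^ (1 + 2 * card P)) \<in> lowp (1 + 2 * card P)
    \<and> sph (\<lambda>x. (x \<bullet> y) * (\<Prod>a\<in>P. (x \<bullet> y)\<^sup>2 - a\<^sup>2)) \<in> homp (1 + 2 * card P)"
  using assms
proof (induction P rule: finite_induct)
  case empty
  have "sph (\<lambda>x. (x \<bullet> y) * (\<Prod>a\<in>({} :: real set). (x \<bullet> y)\<^sup>2 - a\<^sup>2)) = sph (\<lambda>x. (x \<bullet> y) ^ (1 + 2 * card ({} :: real set)))"
    by simp
  then show ?case
    using sph_inner_power_in[of y "1 + 2 * card ({} :: real set)"] subspace_0[OF subspace_lowp, of "1 + 2 * card ({} :: real set)"]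
    by (simp only: diff_self)
next
  case (insert b P)
  let ?G = "\<lambda>P. sph (\<lambda>x. (x \<bullet> y) * (\<Prod>a\<in>P. (x \<bullet> y)\<^sup>2 - a\<^sup>2))"
  let ?U = "\<lambda>k. sph (\<lambda>x. (x \<bullet> y) ^ k)"
  define k where "k = 1 + 2 * card P"
  have k: "1 + 2 * card (insert b P) = k + 2"
    using insert.hyps by (simp add: k_def)
  have G: "?G P - ?U k \<in> lowp k" "?G P \<in> homp k"
    using insert.IH unfolding k_def by blast+
  have U2: "?U 2 \<in> homp 2"
    by (rule sph_inner_power_in)
  have rec: "?G (insert b P) = ?G P * ?U 2 - b\<^sup>2 *\<^sub>R ?G P"
    unfolding sph_times sph_scaleR sph_diff using insert.hyps by (intro sph_cong) (simp add: algebra_simps)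
  have UU: "?U k * ?U 2 = ?U (k + 2)"
    by (simp add: sph_times flip: power_add)
  have low: "b\<^sup>2 *\<^sub>R ?G P \<in> lowp (k + 2)"
    using G(2) unfolding lowp_Suc_Suc by (rule subspace_scale[OF subspace_homp])
  have "(?G P - ?U k) * ?U 2 \<in> lowp (k + 2)"
    using G(1) U2 by (rule lowp_times_homp)
  then have "(?G P - ?U k) * ?U 2 - b\<^sup>2 *\<^sub>R ?G P \<in> lowp (k + 2)"
    using low by (rule subspace_diff[OF subspace_lowp])
  also have "(?G P - ?U k) * ?U 2 - b\<^sup>2 *\<^sub>R ?G P = ?G (insert b P) - ?U (k + 2)"
    unfolding rec left_diff_distrib UU by (simp add: fun_eq_iff)
  finally have "?G (insert b P) - ?U (k + 2) \<in> lowp (k + 2)" .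
  moreover have "?G (insert b P) \<in> homp (k + 2)"
    unfolding rec using homp_times[OF G(2) U2] low lowp_subset_homp[of "k + 2"]
    by (intro subspace_diff[OF subspace_homp]) auto
  ultimately show ?case
    unfolding k by blast
qed

lemma inner_unit_abs_less_1:
  fixes x y :: "'a::real_inner"
  assumes "norm x = 1" "norm y = 1" "x \<noteq> y" "x \<noteq> - y"
  shows "\<bar>x \<bullet> y\<bar> < 1"
proof -
  have "0 < (x - y) \<bullet> (x - y)" "0 < (x + y) \<bullet> (x + y)"
    using assms by (auto simp: eq_neg_iff_add_eq_0)
  moreover have "x \<bullet> x = 1" "y \<bullet> y = 1"
    using assms by (simp_all add: norm_eq_1)
  ultimately show ?thesis
    by (simp add: inner_diff_left inner_diff_right inner_add_left inner_add_right inner_commute)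
qed

text \<open>Apart from \<open>-1\<close>, the angles come in pairs \<open>\<plusminus>a\<close>, possibly together with \<open>0\<close>; the parity
  of \<open>s\<close> forces \<open>0\<close> to be an angle.\<close>

lemma antipodal_angles:
  fixes X :: "(real ^ 'n) set"
  assumes s: "distance_set s X" and X: "antipodal X" and "even s" "0 < s"
  obtains P where "finite P" "1 + 2 * card P = s - 1" "\<And>a. a \<in> P \<Longrightarrow> 0 < a \<and> a < 1"
    "\<And>x y. x \<in> X \<Longrightarrow> y \<in> X \<Longrightarrow> x \<noteq> y \<Longrightarrow> x \<noteq> - y \<Longrightarrow> x \<bullet> y = 0 \<or> \<bar>x \<bullet> y\<bar> \<in> P"
proof -
  let ?A = "angle_set X - {-1}"
  define P where "P = {a \<in> ?A. 0 < a}"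
  have XS: "norm x = 1" if "x \<in> X" for x
    using s that by (auto simp: distance_set_def)
  have neg: "- x \<in> X" if "x \<in> X" for x
    using X that by (auto simp: antipodal_def)
  have fin: "finite (angle_set X)" "card (angle_set X) = s"
    using s by (auto simp: distance_set_def)
  obtain x0 where x0: "x0 \<in> X"
    using fin(2) \<open>0 < s\<close> by (fastforce simp: angle_set_def card_gt_0_iff)
  have "x0 \<bullet> (- x0) = -1" "x0 \<noteq> - x0"
    using XS[OF x0] unit_neq_uminus[of x0] by (simp_all add: norm_eq_1)
  then have "-1 \<in> angle_set X"
    using x0 neg[OF x0] unfolding angle_set_def by force
  then have cardA: "card ?A = s - 1"
    using fin by simp
  have A: "\<exists>x y. x \<in> X \<and> y \<in> X \<and> x \<noteq> y \<and> x \<noteq> - y \<and> a = x \<bullet> y" if a: "a \<in> ?A" for a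
  proof -
    obtain x y where *: "x \<in> X" "y \<in> X" "x \<noteq> y" "a = x \<bullet> y" "a \<noteq> -1"
      using a unfolding angle_set_def by blast
    moreover have "x \<noteq> - y"
      using * XS[of y] by (auto simp: norm_eq_1)
    ultimately show ?thesis
      by blast
  qed
  have Aabs: "\<bar>a\<bar> < 1" if "a \<in> ?A" for a
    using A[OF that] inner_unit_abs_less_1 XS by metis
  have AI: "x \<bullet> y \<in> ?A" if "x \<in> X" "y \<in> X" "x \<noteq> y" "x \<noteq> - y" for x y
    using that inner_unit_abs_less_1[of x y] XS by (auto simp: angle_set_def)
  \<comment> \<open>Replacing \<open>y\<close> by \<open>- y\<close> reverses the sign of the
    angle.\<close>
  have Aneg: "- a \<in> ?A" if a: "a \<in> ?A" for a
  proof -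
    obtain x y where "x \<in> X" "y \<in> X" "x \<noteq> y" "x \<noteq> - y" "a = x \<bullet> y"
      using A[OF a] by blast
    then show ?thesis
      using AI[of x "- y"] neg by simp
  qed
  have finP: "finite P"
    using fin by (simp add: P_def)
  have eq: "?A = (P \<union> uminus ` P) \<union> (?A \<inter> {0})"
  proof (intro equalityI subsetI)
    fix a assume "a \<in> ?A"
    then show "a \<in> (P \<union> uminus ` P) \<union> (?A \<inter> {0})"
      using Aneg[of a] by (cases a "0 :: real" rule: linorder_cases) (auto simp: P_def image_iff)
  next
    fix a assume "a \<in> (P \<union> uminus ` P) \<union> (?A \<inter> {0})"
    then consider "a \<in> P" | b where "b \<in> P" "a = - b" | "a \<in> ?A"
      by blast
    then show "a \<in> ?A"
    proof cases
      case 2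
      then show ?thesis
        using Aneg[of b] by (simp add: P_def)
    qed (auto simp: P_def)
  qed
  have "card (P \<union> uminus ` P) = card P + card (uminus ` P)"
    using finP by (intro card_Un_disjoint) (auto simp: P_def)
  also have "card (uminus ` P) = card P"
    by (rule card_image) auto
  finally have "card ?A = 2 * card P + card (?A \<inter> {0})"
    using finP by (subst eq, subst card_Un_disjoint) (auto simp: P_def)
  moreover have "card (?A \<inter> {0}) \<le> card {0 :: real}"
    by (intro card_mono) auto
  moreover have "odd (s - 1)"
    using \<open>even s\<close> \<open>0 < s\<close> by simp
  ultimately have "1 + 2 * card P = s - 1"
    using cardA by (cases "card (?A \<inter> {0})") auto
  moreover have "0 < a \<and> a < 1" if "a \<in> P" for a
    using that Aabs[of a] by (auto simp: P_def)
  moreover have "x \<bullet> y = 0 \<or> \<bar>x \<bullet> y\<bar> \<in> P" if "x \<in> X" "y \<in> X" "x \<noteq> y" "x \<noteq> - y" for x y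
    using AI[OF that] Aneg[OF AI[OF that]] by (auto simp: P_def abs_if)
  ultimately show ?thesis
    using that finP by blast
qed

text \<open>Serves to factor a monomial of degree \<open>t + 1\<close> into monomials of degrees
  \<open>k\<close> and \<open>m\<close>.\<close>

lemma exists_smaller_exponent:
  fixes \<alpha> :: "'i::finite \<Rightarrow> nat"
  assumes "k \<le> sum \<alpha> UNIV"
  obtains \<beta> where "\<And>i. \<beta> i \<le> \<alpha> i" "sum \<beta> UNIV = k"
proof -
  have "\<exists>\<beta>. (\<forall>i. \<beta> i \<le> \<alpha> i) \<and> sum \<beta> UNIV = k"
    using assms
  proof (induction k)
    case 0
    show ?case
      by (rule exI[of _ "\<lambda>_. 0"]) simp
  next
    case (Suc k)
    then obtain \<beta> where \<beta>: "\<And>i. \<beta> i \<le> \<alpha> i" "sum \<beta> UNIV = k"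
      by auto
    have "\<exists>j. \<beta> j < \<alpha> j"
    proof (rule ccontr)
      assume "\<not> ?thesis"
      then have "sum \<alpha> UNIV \<le> sum \<beta> UNIV"
        by (intro sum_mono) (simp add: not_less)
      then show False
        using Suc.prems \<beta>(2) by simp
    qed
    then obtain j where j: "\<beta> j < \<alpha> j" ..
    have "sum (\<beta>(j := Suc (\<beta> j))) UNIV = Suc k"
      using \<beta>(2) by (simp add: sum.remove[of UNIV j])
    then show ?case
      using \<beta>(1) j by (intro exI[of _ "\<beta>(j := Suc (\<beta> j))"]) (auto simp: Suc_le_eq)
  qed
  then show ?thesis
    using that by blast
qed

subsection \<open>Antipodal designs with an annihilating polynomial\<close>

text \<open>To be used with \<open>m = s - 1\<close> and \<open>k = t + 2 - s\<close>. The
  annihilator enters as a mere function; its degree and leading coefficient are recorded by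
  \<open>phi_homp\<close> and \<open>phi_monic\<close>.\<close>

locale annihilated_design =
  fixes X :: "(real ^ 'n) set" and \<phi> :: "real \<Rightarrow> real" and m k t :: nat
  assumes dim: "CARD('n) \<ge> 2"
    and X: "antipodal X" "spherical_design t X"
    and km: "odd k" "odd m" "k < m" "k + m = Suc t"
    and annihilates: "\<And>x y. x \<in> X \<Longrightarrow> y \<in> X \<Longrightarrow> x \<noteq> y \<Longrightarrow> x \<noteq> - y \<Longrightarrow> \<phi> (x \<bullet> y) = 0"
    and phi_odd: "\<And>u. \<phi> (- u) = - \<phi> u"
    and phi_1: "\<phi> 1 \<noteq> 0"
    and phi_homp: "\<And>y :: real ^ 'n. norm y = 1 \<Longrightarrow> sph (\<lambda>x. \<phi> (x \<bullet> y)) \<in> homp m"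
    and phi_monic: "\<And>y :: real ^ 'n. norm y = 1 \<Longrightarrow> sph (\<lambda>x. \<phi> (x \<bullet> y)) - sph (\<lambda>x. (x \<bullet> y) ^ m) \<in> lowp m"
begin

definition kernel :: "real ^ 'n \<Rightarrow> real ^ 'n \<Rightarrow> real"
  where "kernel y = sph (\<lambda>x. \<phi> (x \<bullet> y))"

definition T :: "(real ^ 'n \<Rightarrow> real) \<Rightarrow> real ^ 'n \<Rightarrow> real"
  where "T h = (\<Sum>y\<in>X. h y *\<^sub>R kernel y)"

text \<open>The Funk-Hecke eigenvalue of the kernel in degree \<open>j\<close>, common to all
  \<open>y\<close>.\<close>

definition eigval :: "nat \<Rightarrow> real"
  where "eigval j = (SOME c. \<forall>y q. norm y = 1 \<longrightarrow> q \<in> sharm j \<longrightarrow> sph_ip (kernel y) q = c * q y)"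

lemma finite_X: "finite X" and norm_X: "x \<in> X \<Longrightarrow> norm x = 1" and uminus_X: "x \<in> X \<Longrightarrow> - x \<in> X"
  using X by (auto simp: spherical_design_def antipodal_def)

lemma kernel_bounded_borel: "norm y = 1 \<Longrightarrow> kernel y \<in> bounded_borel"
  unfolding kernel_def by (rule homp_bounded_borel[OF phi_homp])

lemma kernel_ip:
  assumes "norm y = 1" "q \<in> sharm j"
  shows "sph_ip (kernel y) q = eigval j * q y"
proof -
  obtain c where "\<And>y q. norm y = 1 \<Longrightarrow> q \<in> sharm j \<Longrightarrow> sph_ip (kernel y) q = c * q y"
    using funk_hecke[OF dim, of kernel \<phi> j] kernel_def kernel_bounded_borel by metis
  then have "\<exists>c. \<forall>y q. norm y = 1 \<longrightarrow> q \<in> sharm j \<longrightarrow> sph_ip (kernel y) q = c * q y"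
    by blast
  from someI_ex[OF this] show ?thesis
    using assms unfolding eigval_def by blast
qed

text \<open>If it were 0, the harmonic part of \<open>kernel y\<close> would be orthogonal to itself
  and the kernel would lie in \<open>lowp m\<close>. Its leading part, the \<open>m\<close>-th power
  of the inner product, does not.\<close>

lemma eigval_m_nonzero: "eigval m \<noteq> 0"
proof
  assume 0: "eigval m = 0"
  obtain y :: "real ^ 'n" where y: "norm y = 1"
    using vector_choose_size[of 1] by auto
  have K: "kernel y \<in> homp m"
    using phi_homp[OF y] by (simp add: kernel_def)
  then obtain w p where wp: "w \<in> sharm m" "p \<in> lowp m" "kernel y = w + p"
    by (rule sharm_decomp)
  have "sph_ip (kernel y) w = sph_ip w w + sph_ip p w"
    unfolding wp(3) using wp by (intro sph_ip_add_left) (auto intro: sharm_bounded_borel lowp_bounded_borel)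
  moreover have "sph_ip p w = 0"
    using sharm_lowp_ip[OF wp(1,2)] by (simp add: sph_ip_commute)
  moreover have "sph_ip (kernel y) w = 0"
    using kernel_ip[OF y wp(1)] 0 by simp
  ultimately have "w = 0"
    using sph_ip_self_eq_0[OF sharm_homp[OF wp(1)]] by simp
  then have "kernel y \<in> lowp m"
    using wp by simp
  then have "kernel y - (kernel y - sph (\<lambda>x. (x \<bullet> y) ^ m)) \<in> lowp m"
    using phi_monic[OF y] unfolding kernel_def by (rule subspace_diff[OF subspace_lowp])
  then have "sph (\<lambda>x. (x \<bullet> y) ^ m) \<in> lowp m"
    by (simp only: diff_diff_eq2 add_diff_cancel_left' diff_add_cancel)
  then show False
    using inner_power_notin_lowp[OF dim y] by blast
qed

lemma kernel_X:
  assumes "x \<in> X" "y \<in> X"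
  shows "kernel y x = (if y = x then \<phi> 1 else if y = - x then - \<phi> 1 else 0)"
proof -
  have "x \<bullet> x = 1" "norm x = 1"
    using norm_X[OF assms(1)] by (simp_all add: norm_eq_1)
  then show ?thesis
    using annihilates[OF assms] phi_odd[of 1] equation_minus_iff[of x y] by (auto simp: kernel_def sph_apply)
qed

lemma linear_T: "linear T"
  by (rule linearI)
     (simp_all add: T_def scaleR_add_left sum.distrib scaleR_sum_right)

lemma T_homp: "T h \<in> homp m"
  unfolding T_def using phi_homp[OF norm_X] kernel_def
  by (intro subspace_sum[OF subspace_homp] subspace_scale[OF subspace_homp]) auto

text \<open>Only \<open>y = x\<close> and \<open>y = - x\<close> contribute, and they contribute
  equally because \<open>h\<close> and \<open>\<phi>\<close> are both odd.\<close>

lemma T_X: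
  assumes h: "h \<in> homp k" and x: "x \<in> X"
  shows "T h x = 2 * \<phi> 1 * h x"
proof -
  have "x \<noteq> - x"
    using unit_neq_uminus norm_X[OF x] .
  have "T h x = (\<Sum>y\<in>X. h y * kernel y x)"
    by (simp add: T_def)
  also have "\<dots> = (\<Sum>y\<in>{x, - x}. h y * kernel y x)"
    using x uminus_X[OF x] finite_X kernel_X[OF x]
    by (intro sum.mono_neutral_right) auto
  also have "\<dots> = h x * \<phi> 1 + h (- x) * (- \<phi> 1)"
    using \<open>x \<noteq> - x\<close> kernel_X[OF x] x uminus_X[OF x] by simp
  also have "h (- x) = - h x"
    using homp_uminus[OF h] km(1) by simp
  finally show ?thesis
    by simp
qed

lemma T_ip_sharm:
  assumes "q \<in> sharm j"
  shows "sph_ip (T h) q = eigval j * (\<Sum>y\<in>X. h y * q y)"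
proof -
  have "sph_ip (T h) q = (\<Sum>y\<in>X. sph_ip (h y *\<^sub>R kernel y) q)"
    unfolding T_def using kernel_bounded_borel[OF norm_X] assms
    by (intro sph_ip_sum_left subspace_scale[OF subspace_bounded_borel]) (auto intro: sharm_bounded_borel)
  also have "\<dots> = (\<Sum>y\<in>X. eigval j * (h y * q y))"
    using kernel_ip[OF norm_X assms] by (intro sum.cong) (auto simp: sph_ip_scaleR_left)
  finally show ?thesis
    by (simp add: sum_distrib_left)
qed

lemma sum_X_homp:
  assumes "f \<in> homp i" "g \<in> homp j" "i + j \<le> t"
  shows "(\<Sum>x\<in>X. f x * g x) = real (card X) * sph_ip f g"
  using sum_design[OF X(2) homp_times[OF assms(1,2)] assms(3)] by (simp add: sph_ip_def)

text \<open>Against forms of odd degree below \<open>m\<close>, \<open>T\<close> acts on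
  \<open>h\<close> as the scalar \<open>real (card X) * eigval k\<close>. The form is split into its
  harmonic part \<open>w\<close> and a remainder of smaller degree; for \<open>w\<close> the sum
  over \<open>X\<close> is an integral, which vanishes unless \<open>j = k\<close>.\<close>

lemma T_ip_low:
  assumes h: "h \<in> sharm k"
  shows "p \<in> homp j \<Longrightarrow> odd j \<Longrightarrow> j < m \<Longrightarrow> sph_ip (T h) p = real (card X) * eigval k * sph_ip h p"
proof (induction j arbitrary: p rule: less_induct)
  case (less j)
  obtain w q where wq: "w \<in> sharm j" "q \<in> lowp j" "p = w + q"
    using sharm_decomp[OF less.prems(1)] by blast
  have bounded_borel: "T h \<in> bounded_borel" "h \<in> bounded_borel" "w \<in> bounded_borel" "q \<in> bounded_borel"
    using wq h homp_bounded_borel[OF T_homp] by (auto intro: sharm_bounded_borel lowp_bounded_borel)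
  have "sph_ip (T h) q = real (card X) * eigval k * sph_ip h q"
  proof (cases "j < 2")
    case True
    then show ?thesis
      using wq(2) by (simp add: lowp_small sph_ip_zero_right)
  next
    case False
    then have "q \<in> homp (j - 2)"
      using wq(2) by (simp add: lowp_eq)
    then show ?thesis
      using less.IH[of "j - 2" q] less.prems False by simp
  qed
  moreover have "sph_ip (T h) w = real (card X) * eigval k * sph_ip h w"
  proof -
    \<comment> \<open>Since \<open>j < m\<close> and \<open>k + m = t + 1\<close>, the product of
      \<open>h\<close> and \<open>w\<close> is still within reach of the design property.\<close>
    have "k + j \<le> t"
      using km less.prems by simp
    then have *: "sph_ip (T h) w = eigval j * (real (card X) * sph_ip h w)"
      using T_ip_sharm[OF wq(1), of h] sum_X_homp[OF sharm_homp[OF h] sharm_homp[OF wq(1)]] by simp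
    consider "j = k" | "j < k" | "k < j"
      by linarith
    then show ?thesis
    proof cases
      case 1
      then show ?thesis
        using * by simp
    next
      case 2
      then have "w \<in> lowp k"
        using homp_subset_lowp[of j k] sharm_homp[OF wq(1)] less.prems km by auto
      then show ?thesis
        using * sharm_lowp_ip[OF h] by simp
    next
      case 3
      then have "h \<in> lowp j"
        using homp_subset_lowp[of k j] sharm_homp[OF h] less.prems km by auto
      then show ?thesis
        using * sharm_lowp_ip[OF wq(1), of h] by (simp add: sph_ip_commute)
    qed
  qed
  ultimately show ?case
    using bounded_borel unfolding wq(3) by (simp only: sph_ip_add_right distrib_left)
qed

text \<open>Compares the factor by which \<open>T\<close> acts on \<open>X\<close> with the factor
  of the degree \<open>k\<close> part of \<open>T h\<close>; whether they agree separates the two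
  cases.\<close>

definition lam :: real
  where "lam = 2 * \<phi> 1 - real (card X) * eigval k"

text \<open>Orthogonality to \<open>lowp m\<close> is \<open>T_ip_low\<close> in degree
  \<open>m - 2\<close>.\<close>

lemma T_remainder:
  assumes h: "h \<in> sharm k"
  shows "T h - (real (card X) * eigval k) *\<^sub>R h \<in> sharm m"
proof -
  let ?c = "real (card X) * eigval k"
  have hm: "h \<in> homp m"
    using homp_subset_homp[of k m] sharm_homp[OF h] km by auto
  have ch: "?c *\<^sub>R h \<in> homp m"
    using hm by (rule subspace_scale[OF subspace_homp])
  have "sph_ip (T h - ?c *\<^sub>R h) p = 0" if p: "p \<in> lowp m" for p
  proof (cases "m < 2")
    case True
    then show ?thesis
      using p by (simp add: lowp_small sph_ip_zero_right)
  next
    case False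
    then have "p \<in> homp (m - 2)"
      using p by (simp add: lowp_eq)
    then have "sph_ip (T h) p = ?c * sph_ip h p"
      using T_ip_low[OF h, of p "m - 2"] km False by simp
    then show ?thesis
      using homp_bounded_borel[OF T_homp] homp_bounded_borel[OF ch] lowp_bounded_borel[OF p]
      by (simp add: sph_ip_diff_left sph_ip_scaleR_left)
  qed
  then show ?thesis
    using subspace_diff[OF subspace_homp T_homp ch] by (simp add: sharm_def)
qed

text \<open>The kernels at points of \<open>Y\<close> and the functions \<open>u b\<close>, for
  \<open>b\<close> in a basis of the harmonics of degree \<open>k\<close>, are jointly independent
  in \<open>homp m\<close>. Evaluation on \<open>Y\<close> kills each \<open>u b\<close> and
  isolates the coefficients of the kernels; injectivity of \<open>u\<close> handles the
  rest.\<close>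

lemma card_le_if_lam_nonzero:
  assumes lam: "lam \<noteq> 0" and Y: "Y \<subseteq> X" "\<And>y. y \<in> Y \<Longrightarrow> - y \<notin> Y"
  shows "int (card Y) + h_dim CARD('n) k \<le> int ((CARD('n) + m - 1) choose m)"
proof -
  have "sharm k \<subseteq> homp k"
    by (auto simp: sharm_def)
  then obtain B :: "(real ^ 'n \<Rightarrow> real) set" where B: "finite B" "independent B" "span B = sharm k"
    using finite_basis_homp[OF subspace_sharm] by blast
  have finY: "finite Y"
    using Y(1) finite_X finite_subset by blast
  have Bh: "b \<in> sharm k" if "b \<in> B" for b
    using that B(3) span_base by blast
  define u where "u h = T h - (2 * \<phi> 1) *\<^sub>R h" for h
  have lin: "linear u"
    unfolding u_def by (intro linear_compose_sub linear_T linear_scale_self)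
  have u_homp: "u h \<in> homp m" if "h \<in> sharm k" for h
    unfolding u_def using homp_subset_homp[of k m] sharm_homp[OF that] km
    by (intro subspace_diff[OF subspace_homp] T_homp subspace_scale[OF subspace_homp]) auto
  have u_X: "u h x = 0" if "h \<in> sharm k" "x \<in> X" for h x
    using T_X[OF sharm_homp[OF that(1)] that(2)] by (simp add: u_def)
  \<comment> \<open>If \<open>u h = 0\<close>, the remainder, harmonic of degree \<open>m\<close>,
    equals \<open>lam *\<^sub>R h\<close>. It is orthogonal to \<open>h\<close>, whose degree is
    smaller, so \<open>h = 0\<close>.\<close>
  have u_inj: "h = 0" if h: "h \<in> sharm k" and u0: "u h = 0" for h
  proof -
    let ?g = "T h - (real (card X) * eigval k) *\<^sub>R h"
    have "?g = lam *\<^sub>R h"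
      using u0 by (simp add: u_def lam_def scaleR_diff_left)
    moreover have "h \<in> lowp m"
      using homp_subset_lowp[of k m] sharm_homp[OF h] km by auto
    ultimately have "sph_ip (lam *\<^sub>R h) h = 0"
      using sharm_lowp_ip[OF T_remainder[OF h], of h] by simp
    then show ?thesis
      using lam sph_ip_self_eq_0[OF sharm_homp[OF h]] by (simp add: sph_ip_scaleR_left)
  qed
  have "card (Y <+> B) \<le> card (sph_monom ` exps m :: (real ^ 'n \<Rightarrow> real) set)"
  proof (rule lin_indep_family_card_le[where f = "case_sum kernel u"])
    fix i assume "i \<in> Y <+> B"
    then show "case_sum kernel u i \<in> span (sph_monom ` exps m)"
      using phi_homp[OF norm_X] Y(1) u_homp Bh by (auto simp: kernel_def homp_def)
  next
    fix c i assume c: "(\<Sum>i\<in>Y <+> B. c i *\<^sub>R case_sum kernel u i) = 0" and i: "i \<in> Y <+> B"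
    have eq: "(\<Sum>y\<in>Y. c (Inl y) *\<^sub>R kernel y) + (\<Sum>b\<in>B. c (Inr b) *\<^sub>R u b) = 0"
      using c finY B(1) by (simp add: sum.Plus)
    have cY: "c (Inl z) = 0" if z: "z \<in> Y" for z
    proof -
      have "(\<Sum>y\<in>Y. c (Inl y) * kernel y z) + (\<Sum>b\<in>B. c (Inr b) * u b z) = 0"
        using fun_cong[OF eq, of z] by simp
      moreover have "(\<Sum>b\<in>B. c (Inr b) * u b z) = 0"
        using u_X Bh z Y(1) by (intro sum.neutral) auto
      \<comment> \<open>\<open>Y\<close> contains no antipodal pair, so the value
        \<open>- \<phi> 1\<close> does not occur.\<close>
      moreover have "kernel y z = (if y = z then \<phi> 1 else 0)" if "y \<in> Y" for y
      proof -
        have "z \<in> X" "y \<in> X" "y \<noteq> - z"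
          using that Y(1) Y(2)[OF z] z by auto
        then show ?thesis
          using kernel_X[of z y] by simp
      qed
      then have "(\<Sum>y\<in>Y. c (Inl y) * kernel y z) = (\<Sum>y\<in>Y. if y = z then c (Inl y) * \<phi> 1 else 0)"
        by (intro sum.cong) auto
      ultimately show ?thesis
        using finY z phi_1 by simp
    qed
    then have "(\<Sum>b\<in>B. c (Inr b) *\<^sub>R u b) = 0"
      using eq by simp
    then have "u (\<Sum>b\<in>B. c (Inr b) *\<^sub>R b) = 0"
      using lin by (simp add: linear_sum linear_scale)
    moreover have "(\<Sum>b\<in>B. c (Inr b) *\<^sub>R b) \<in> sharm k"
      using Bh by (intro subspace_sum[OF subspace_sharm] subspace_scale[OF subspace_sharm])
    ultimately have "(\<Sum>b\<in>B. c (Inr b) *\<^sub>R b) = 0"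
      using u_inj by blast
    then have "c (Inr b) = 0" if "b \<in> B" for b
      using independentD[OF B(2,1) order_refl, of "\<lambda>b. c (Inr b)"] that by blast
    with cY show "c i = 0"
      using i by auto
  qed (use finY B(1) finite_exps in auto)
  also have "\<dots> \<le> card (exps m :: ('n \<Rightarrow> nat) set)"
    by (rule card_image_le[OF finite_exps])
  finally have "card Y + card B \<le> (CARD('n) + m - 1) choose m"
    using finY B(1) by (simp add: card_Plus card_exps)
  moreover have "h_dim CARD('n) k \<le> int (card B)"
    using km(1) B by (intro h_dim_le_card_basis) (auto intro: odd_pos)
  ultimately show ?thesis
    by linarith
qed

text \<open>For \<open>lam = 0\<close> the remainder \<open>g\<close> vanishes on \<open>X\<close>.
  Pairing \<open>g\<close> with itself gives a sum over \<open>X\<close> with factor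
  \<open>g x\<close>, so \<open>g = 0\<close>; pairing it with \<open>q\<close> and dividing by
  \<open>eigval m\<close> shows that the sum is 0, as is the integral.\<close>

lemma sum_X_if_lam_zero:
  assumes lam: "lam = 0" and h: "h \<in> sharm k" and q: "q \<in> sharm m"
  shows "(\<Sum>x\<in>X. h x * q x) = real (card X) * sph_ip h q"
proof -
  let ?c = "real (card X) * eigval k"
  define g where "g = T h - ?c *\<^sub>R h"
  have g: "g \<in> sharm m"
    unfolding g_def by (rule T_remainder[OF h])
  have "h \<in> lowp m"
    using homp_subset_lowp[of k m] sharm_homp[OF h] km by auto
  then have hp: "sph_ip h p = 0" if "p \<in> sharm m" for p
    using sharm_lowp_ip[OF that, of h] by (simp add: sph_ip_commute)
  have gp: "sph_ip g p = eigval m * (\<Sum>x\<in>X. h x * p x)" if p: "p \<in> sharm m" for p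
  proof -
    have "?c *\<^sub>R h \<in> bounded_borel"
      using sharm_bounded_borel[OF h] by (rule subspace_scale[OF subspace_bounded_borel])
    then have "sph_ip g p = sph_ip (T h) p - ?c * sph_ip h p"
      unfolding g_def using homp_bounded_borel[OF T_homp] sharm_bounded_borel[OF p]
      by (simp add: sph_ip_diff_left sph_ip_scaleR_left)
    then show ?thesis
      using hp[OF p] T_ip_sharm[OF p] by simp
  qed
  have "g x = 0" if "x \<in> X" for x
    using T_X[OF sharm_homp[OF h] that] lam by (simp add: g_def lam_def)
  then have "sph_ip g g = 0"
    using gp[OF g] by simp
  then have "g = 0"
    using sph_ip_self_eq_0 sharm_homp[OF g] by blast
  then have "(\<Sum>x\<in>X. h x * q x) = 0"
    using gp[OF q] eigval_m_nonzero by (simp add: sph_ip_zero_left)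
  then show ?thesis
    using hp[OF q] by simp
qed

text \<open>A monomial of degree \<open>t + 1\<close> is a product \<open>f * g\<close> of degrees
  \<open>k\<close> and \<open>m\<close>. After splitting off the harmonic parts \<open>h\<close> and
  \<open>q\<close>, the products \<open>h * r\<close> and \<open>p * g\<close> have degree at most
  \<open>t - 1\<close>, and \<open>h * q\<close> is the case just settled.\<close>

lemma design_if_lam_zero:
  assumes lam: "lam = 0" and "X \<noteq> {}"
  shows "spherical_design (Suc t) X"
proof -
  have 1: "(\<Sum>x\<in>X. f x * g x) = real (card X) * sph_ip f g"
    if f: "f \<in> homp k" and g: "g \<in> homp m" for f g
  proof -
    obtain h p where hp: "h \<in> sharm k" "p \<in> lowp k" "f = h + p"
      using sharm_decomp[OF f] by blast
    obtain q r where qr: "q \<in> sharm m" "r \<in> lowp m" "g = q + r"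
      using sharm_decomp[OF g] by blast
    have hr: "(\<Sum>x\<in>X. h x * r x) = real (card X) * sph_ip h r"
    proof (cases "m < 2")
      case True
      then show ?thesis
        using qr(2) by (simp add: lowp_small sph_ip_zero_right)
    next
      case False
      then show ?thesis
        using qr(2) km by (intro sum_X_homp[OF sharm_homp[OF hp(1)]]) (auto simp: lowp_eq)
    qed
    have pg: "(\<Sum>x\<in>X. p x * g x) = real (card X) * sph_ip p g"
    proof (cases "k < 2")
      case True
      then show ?thesis
        using hp(2) by (simp add: lowp_small sph_ip_zero_left)
    next
      case False
      then show ?thesis
        using hp(2) g km by (intro sum_X_homp[of _ "k - 2" _ m]) (auto simp: lowp_eq)
    qed
    have "(\<Sum>x\<in>X. f x * g x) = (\<Sum>x\<in>X. h x * q x) + (\<Sum>x\<in>X. h x * r x) + (\<Sum>x\<in>X. p x * g x)"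
      by (simp add: hp(3) qr(3) algebra_simps sum.distrib)
    moreover have bounded_borel: "h \<in> bounded_borel" "p \<in> bounded_borel" "q \<in> bounded_borel" "r \<in> bounded_borel" "g \<in> bounded_borel"
      using hp qr homp_bounded_borel[OF g] by (auto intro: sharm_bounded_borel lowp_bounded_borel)
    then have "sph_ip f g = sph_ip h g + sph_ip p g" "sph_ip h g = sph_ip h q + sph_ip h r"
      unfolding hp(3) qr(3) using bounded_borel by (simp_all add: sph_ip_add_left sph_ip_add_right subspace_add[OF subspace_bounded_borel])
    ultimately show ?thesis
      using hr pg sum_X_if_lam_zero[OF lam hp(1) qr(1)] by (simp add: distrib_left)
  qed
  show ?thesis
  proof (rule spherical_design_Suc[OF X(2) \<open>X \<noteq> {}\<close>])
    fix \<alpha> :: "'n \<Rightarrow> nat" assume \<alpha>: "sum \<alpha> UNIV = Suc t"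
    obtain \<beta> :: "'n \<Rightarrow> nat" where \<beta>: "\<And>i. \<beta> i \<le> \<alpha> i" "sum \<beta> UNIV = k"
      using exists_smaller_exponent[of k \<alpha>] \<alpha> km by auto
    define \<gamma> where "\<gamma> = (\<lambda>i. \<alpha> i - \<beta> i)"
    have "\<alpha> = \<beta> + \<gamma>"
      using \<beta>(1) by (simp add: \<gamma>_def fun_eq_iff)
    moreover from this have "sum \<gamma> UNIV = m"
      using \<alpha> \<beta>(2) km by (simp add: sum.distrib)
    ultimately show "(\<Sum>x\<in>X. sph_monom \<alpha> x) = real (card X) * sph_int (sph_monom \<alpha>)"
      using 1[of "sph_monom \<beta>" "sph_monom \<gamma>"] sph_monom_in[of \<beta>] sph_monom_in[of \<gamma>] \<beta>(2)
      by (simp add: sph_ip_def sph_monom_times flip: times_fun_apply)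
  qed
qed

end

section \<open>The annihilating polynomial of the angles and the final bound\<close>

theorem theorem1p1:
  fixes X :: "(real ^ 'n) set" and t s :: nat
  assumes "CARD('n) \<ge> 2"
    and "t \<ge> 3"
    and "even s"
    and "(real t + 5) / 2 \<le> real s"
    and "s \<le> t + 1"
    and "distance_set s X"
    and "antipodal X"
    and "has_strength X t"
  shows "int (card X) \<le>
    2 * int ((CARD('n) + s - 2) choose (s - 1)) - 2 * h_dim (CARD('n)) (t + 2 - s)"
proof -
  have s: "t + 5 \<le> 2 * s"
  proof -
    have "real (t + 5) \<le> real (2 * s)"
      using assms(4) by simp
    then show ?thesis
      by (simp only: of_nat_le_iff)
  qed
  have design: "spherical_design t X" and max: "\<not> spherical_design (Suc t) X"
    using assms(8) by (auto simp: has_strength_def dest: spec[of _ "Suc t"])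
  have "angle_set X \<noteq> {}"
    using assms(6) s by (auto simp: distance_set_def)
  then have ne: "X \<noteq> {}"
    by (auto simp: angle_set_def)
  have "odd t"
    using antipodal_strength_odd[OF assms(7,8) ne] .
  have fin: "finite X" and XS: "X \<subseteq> sphere 0 1"
    using assms(6) by (auto simp: distance_set_def)
  obtain P where P: "finite P" "1 + 2 * card P = s - 1" "\<And>a. a \<in> P \<Longrightarrow> 0 < a \<and> a < 1"
    "\<And>x y. x \<in> X \<Longrightarrow> y \<in> X \<Longrightarrow> x \<noteq> y \<Longrightarrow> x \<noteq> - y \<Longrightarrow> x \<bullet> y = 0 \<or> \<bar>x \<bullet> y\<bar> \<in> P"
    using antipodal_angles[OF assms(6,7,3)] s by auto
  define \<phi> where "\<phi> u = u * (\<Prod>a\<in>P. u\<^sup>2 - a\<^sup>2)" for u :: real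
  interpret annihilated_design X \<phi> "s - 1" "t + 2 - s" t
  proof
    show "odd (t + 2 - s)"
      using \<open>odd t\<close> assms(3,5) by auto
    \<comment> \<open>For \<open>m = s - 1\<close> and \<open>k = t + 2 - s\<close>, the bound
      \<open>t + 5 \<le> 2 * s\<close> says \<open>k + 2 \<le> m\<close>.\<close>
    show "odd (s - 1)" "t + 2 - s < s - 1" "t + 2 - s + (s - 1) = Suc t"
      using assms(3,5) s by auto
    show "\<phi> (- u) = - \<phi> u" for u
      by (simp add: \<phi>_def)
    have "1 - a\<^sup>2 \<noteq> 0" if "a \<in> P" for a
      using P(3)[OF that] by (simp add: power2_eq_1_iff)
    then show "\<phi> 1 \<noteq> 0"
      using P(1) by (simp add: \<phi>_def)
    show "\<phi> (x \<bullet> y) = 0" if "x \<in> X" "y \<in> X" "x \<noteq> y" "x \<noteq> - y" for x y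
    proof (cases "x \<bullet> y = 0")
      case False
      \<comment> \<open>The factor with \<open>a = \<bar>x \<bullet> y\<bar>\<close> vanishes; a
        zero inner product is covered by the linear factor.\<close>
      then have "\<bar>x \<bullet> y\<bar> \<in> P" "(x \<bullet> y)\<^sup>2 - \<bar>x \<bullet> y\<bar>\<^sup>2 = 0"
        using P(4)[OF that] by auto
      then have "(\<Prod>a\<in>P. (x \<bullet> y)\<^sup>2 - a\<^sup>2) = 0"
        using P(1) by (intro prod_zero) blast+
      then show ?thesis
        by (simp add: \<phi>_def)
    qed (simp add: \<phi>_def)
    show "sph (\<lambda>x. \<phi> (x \<bullet> y)) \<in> homp (s - 1)"
      "sph (\<lambda>x. \<phi> (x \<bullet> y)) - sph (\<lambda>x. (x \<bullet> y) ^ (s - 1)) \<in> lowp (s - 1)" for y :: "real ^ 'n"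
      using angle_poly_in[OF P(1), of y] unfolding P(2) \<phi>_def by blast+
  qed (use assms design in auto)
  \<comment> \<open>Otherwise \<open>X\<close> would be a design of degree \<open>t + 1\<close>,
    beyond its strength.\<close>
  have "lam \<noteq> 0"
    using design_if_lam_zero ne max by blast
  obtain Y where Y: "Y \<subseteq> X" "card X = 2 * card Y" "\<And>y. y \<in> Y \<Longrightarrow> - y \<notin> Y"
    using antipodal_half[OF _ fin XS] assms(7) by (metis antipodal_def)
  have "CARD('n) + (s - 1) - 1 = CARD('n) + s - 2"
    using s by simp
  then show ?thesis
    using card_le_if_lam_nonzero[OF \<open>lam \<noteq> 0\<close> Y(1,3)] Y(2) by simp
qed

end
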